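(* Let $A$ be a complex abelian variety of dimension $n$ with $NS_A\cong\mathbb Z$. Then $C_A=NS_A(\mathbb C)^0$, and for any $\omega_A\in C_A$ the algebraic pair $(A,\omega_A)$ has a mirror symmetric pair $(E,\omega_E)$ in which $E=E_1\times\dots\times E_n$ is a product of isogeneous elliptic curves $E_1,\dots,E_n$.
   Context: A complex torus is $A=(V/\Gamma,J)$ with $\Gamma=\Gamma_A=H_1(A,\mathbb Z)$ a lattice of rank $2\dim A$, $V=V_A=\Gamma\otimes\mathbb R$, and $J=J_A\in\mathrm{End}(V)$, $J^2=-1$. The dual torus is $\hat A=(V^*/\Gamma^*,\hat J)$, $(\hat Jw)(v)=w(-Jv)$. The Néron–Severi group $NS_A$ is identified (by first Chern class) with the group of integral skew-symmetric forms $c$ on $\Gamma$ with $c_{\mathbb R}$ $J$-invariant, and with a subgroup of $\mathrm{Hom}(A,\hat A)$ via $c\mapsto(v\mapsto c(v,\cdot))$. $NS_A(\mathbb R)=NS_A\otimes\mathbb R$, $NS_A(\mathbb C)=NS_A\otimes\mathbb C$, $NS_A(\mathbb R)^0\subset NS_A(\mathbb R)$ is the set of nondegenerate forms, and $NS_A(\mathbb C)^0=\{\varphi_1+i\varphi_2\in NS_A(\mathbb C):\varphi_1\in NS_A(\mathbb R),\ \varphi_2\in NS_A(\mathbb R)^0\}$. $C_A^a\subset NS_A(\mathbb R)$ is the ample cone ($\mathbb R^+$-linear combinations of ample classes), and $C_A=(NS_A(\mathbb R)+iC_A^a)\sqcup(NS_A(\mathbb R)-iC_A^a)\subset NS_A(\mathbb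 C)^0$. Put $\Lambda_A=\Gamma_A\oplus\Gamma_{\hat A}$ ($\Gamma_{\hat A}=\Gamma_A^*$) with $Q_A((a_1,b_1),(a_2,b_2))=b_1(a_2)+b_2(a_1)$; $J_{A\times\hat A}=(J,\hat J)$ acts on $V_A\oplus V_{\hat A}$. For $\omega=\varphi_1+i\varphi_2\in NS_A(\mathbb C)^0$ (with $\varphi_k:V_A\to V_{\hat A}$) put $$I_\omega=\begin{pmatrix}\varphi_2^{-1}\varphi_1&-\varphi_2^{-1}\\ \varphi_2+\varphi_1\varphi_2^{-1}\varphi_1&-\varphi_1\varphi_2^{-1}\end{pmatrix},$$ a complex structure on $V_A\oplus V_{\hat A}$. An algebraic pair $(A,\omega_A)$ is an abelian variety $A$ with $\omega_A\in C_A$. Algebraic pairs $(A,\omega_A)$, $(B,\omega_B)$ are mirror symmetric if there is an isomorphism $\alpha:\Lambda_A\to\Lambda_B$ identifying $Q_A$ with $Q_B$ such that $\alpha_{\mathbb R}J_{A\times\hat A}=I_{\omega_B}\alpha_{\mathbb R}$ and $\alpha_{\mathbb R}I_{\omega_A}=J_{B\times\hat B}\alpha_{\mathbb R}$. *)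

theory Defs
  imports "HOL-Analysis.Analysis" "HOL-Algebra.Elementary_Groups"
begin

text \<open>A complex torus \<open>V/\<Gamma>\<close> with complex structure \<open>J\<close> is recorded by its
  period lattice \<open>\<Gamma>\<close>, sitting in the real vector space \<open>V = \<Gamma> \<otimes> \<real>\<close> (the whole type), and
  by \<open>J\<close>. Spaces of linear maps are the types \<open>'a \<Rightarrow>\<^sub>L 'b\<close>; as all spaces below are finite
  dimensional, these contain all linear maps, and the norms play no role.\<close>

record (overloaded) ('v::real_normed_vector) torus =
  periods :: "'v set"
  cstr :: "'v \<Rightarrow>\<^sub>L 'v"

definition full_lattice :: "nat \<Rightarrow> 'v::real_normed_vector set \<Rightarrow> bool" where
  "full_lattice r L \<longleftrightarrow>
     (\<exists>B. finite B \<and> card B = r \<and> independent B \<and> span B = UNIV \<and>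
          L = {\<Sum>b\<in>B. real_of_int (k b) *\<^sub>R b | k. True})"

definition complex_torus :: "nat \<Rightarrow> 'v::real_normed_vector torus \<Rightarrow> bool" where
  "complex_torus n A \<longleftrightarrow>
     full_lattice (2 * n) (periods A) \<and> cstr A o\<^sub>L cstr A = - id_blinfun"

lift_definition dual_cstr ::
  "('v::real_normed_vector \<Rightarrow>\<^sub>L 'v) \<Rightarrow> (('v \<Rightarrow>\<^sub>L real) \<Rightarrow>\<^sub>L ('v \<Rightarrow>\<^sub>L real))"
  is "\<lambda>(J :: 'v \<Rightarrow>\<^sub>L 'v) (w :: 'v \<Rightarrow>\<^sub>L real). w o\<^sub>L (- J)"
  by (rule bounded_bilinear.bounded_linear_left[OF bounded_bilinear_blinfun_compose])

definition dual_torus :: "'v::real_normed_vector torus \<Rightarrow> ('v \<Rightarrow>\<^sub>L real) torus" where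
  "dual_torus A =
     \<lparr>periods = {w :: 'v \<Rightarrow>\<^sub>L real. \<forall>g\<in>periods A. w g \<in> \<int>},
      cstr = dual_cstr (cstr A)\<rparr>"

lift_definition prod_cstr ::
  "('a::real_normed_vector \<Rightarrow>\<^sub>L 'a) \<Rightarrow> ('b::real_normed_vector \<Rightarrow>\<^sub>L 'b) \<Rightarrow> (('a \<times> 'b) \<Rightarrow>\<^sub>L ('a \<times> 'b))"
  is "\<lambda>(J :: 'a \<Rightarrow>\<^sub>L 'a) (K :: 'b \<Rightarrow>\<^sub>L 'b) (x :: 'a \<times> 'b). (J (fst x), K (snd x))"
  by (intro bounded_linear_intros)

definition prod_torus ::
  "'a::real_normed_vector torus \<Rightarrow> 'b::real_normed_vector torus \<Rightarrow> ('a \<times> 'b) torus" where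
  "prod_torus A B = \<lparr>periods = periods A \<times> periods B, cstr = prod_cstr (cstr A) (cstr B)\<rparr>"

lift_definition vec_cstr ::
  "('n::finite \<Rightarrow> 'v::euclidean_space \<Rightarrow>\<^sub>L 'v) \<Rightarrow> (('v ^ 'n) \<Rightarrow>\<^sub>L ('v ^ 'n))"
  is "\<lambda>(J :: 'n \<Rightarrow> 'v \<Rightarrow>\<^sub>L 'v) (x :: 'v ^ 'n). \<chi> i. J i (x $ i)"
  by (intro linear_conv_bounded_linear[THEN iffD1] linearI)
     (simp_all add: vec_eq_iff blinfun.add_right blinfun.scaleR_right)

definition vec_torus :: "('n::finite \<Rightarrow> 'v::euclidean_space torus) \<Rightarrow> ('v ^ 'n) torus" where
  "vec_torus E =
     \<lparr>periods = {x. \<forall>i. x $ i \<in> periods (E i)}, cstr = vec_cstr (\<lambda>i. cstr (E i))\<rparr>"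

definition elliptic_curve :: "'v::real_normed_vector torus \<Rightarrow> bool" where
  "elliptic_curve E \<longleftrightarrow> complex_torus 1 E"

text \<open>A homomorphism \<open>V\<^sub>A/\<Gamma>\<^sub>A \<rightarrow> V\<^sub>B/\<Gamma>\<^sub>B\<close> is given by its lift \<open>V\<^sub>A \<rightarrow> V\<^sub>B\<close>; surjectivity
  and finiteness of the kernel refer to the induced map of the quotients.\<close>

definition torus_hom ::
  "'a::real_normed_vector torus \<Rightarrow> 'b::real_normed_vector torus \<Rightarrow> ('a \<Rightarrow>\<^sub>L 'b) \<Rightarrow> bool" where
  "torus_hom A B f \<longleftrightarrow> f o\<^sub>L cstr A = cstr B o\<^sub>L f \<and> f ` periods A \<subseteq> periods B"

definition isogeny ::
  "'a::real_normed_vector torus \<Rightarrow> 'b::real_normed_vector torus \<Rightarrow> ('a \<Rightarrow>\<^sub>L 'b) \<Rightarrow> bool" where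
  "isogeny A B f \<longleftrightarrow> torus_hom A B f \<and>
     (\<forall>y. \<exists>x. f x - y \<in> periods B) \<and>
     finite ({x. f x \<in> periods B} // {(x, y). x - y \<in> periods A})"

definition isogenous :: "'a::real_normed_vector torus \<Rightarrow> 'b::real_normed_vector torus \<Rightarrow> bool" where
  "isogenous A B \<longleftrightarrow> (\<exists>f. isogeny A B f)"

text \<open>A bilinear form \<open>c\<close> on \<open>V\<close> is identified with the map \<open>v \<mapsto> c(v, \<cdot>)\<close> from \<open>V\<close> to its
  dual.\<close>

type_synonym 'v form = "'v \<Rightarrow>\<^sub>L 'v \<Rightarrow>\<^sub>L real"

definition NS :: "'v::real_normed_vector torus \<Rightarrow> 'v form set" where
  "NS A = {c :: 'v form. (\<forall>x y. c x y = - c y x) \<and>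
              (\<forall>x\<in>periods A. \<forall>y\<in>periods A. c x y \<in> \<int>) \<and>
              (\<forall>x y. c (cstr A x) (cstr A y) = c x y)}"

definition NS_group :: "'v::real_normed_vector torus \<Rightarrow> 'v form monoid" where
  "NS_group A = \<lparr>carrier = NS A, mult = (+), one = 0\<rparr>"

text \<open>Integral forms that are linearly independent over \<open>\<int>\<close> are so over \<open>\<real>\<close>, hence
  \<open>NS \<otimes> \<real>\<close> is the real span of \<open>NS\<close>.\<close>

definition NS_real :: "'v::real_normed_vector torus \<Rightarrow> 'v form set" where
  "NS_real A = span (NS A)"

definition NS_real_nondeg :: "'v::real_normed_vector torus \<Rightarrow> 'v form set" where
  "NS_real_nondeg A = {c \<in> NS_real A. \<forall>v. (\<forall>u. c v u = 0) \<longrightarrow> v = 0}"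

text \<open>An element \<open>\<phi>\<^sub>1 + i \<phi>\<^sub>2\<close> of \<open>NS \<otimes> \<complex>\<close> is the pair \<open>(\<phi>\<^sub>1, \<phi>\<^sub>2)\<close> of its real and
  imaginary parts.\<close>

definition NS_complex_nondeg :: "'v::real_normed_vector torus \<Rightarrow> ('v form \<times> 'v form) set" where
  "NS_complex_nondeg A = NS_real A \<times> NS_real_nondeg A"

text \<open>Ampleness of a line bundle with first Chern class \<open>c\<close> is positivity of its Hermitian
  form. The sign is that of Kaehler forms; with the opposite sign convention ample classes are
  replaced by their negatives, which leaves \<open>abelian_variety\<close> and \<open>kaehler_domain\<close> below
  unchanged.\<close>

definition ample :: "'v::real_normed_vector torus \<Rightarrow> 'v form \<Rightarrow> bool" where
  "ample A c \<longleftrightarrow> c \<in> NS A \<and> (\<forall>v. v \<noteq> 0 \<longrightarrow> c v (cstr A v) > 0)"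

definition ample_cone :: "'v::real_normed_vector torus \<Rightarrow> 'v form set" where
  "ample_cone A = {\<Sum>c\<in>S. r c *\<^sub>R c | S r.
     finite S \<and> S \<noteq> {} \<and> (\<forall>c\<in>S. ample A c \<and> r c > 0)}"

definition abelian_variety :: "nat \<Rightarrow> 'v::real_normed_vector torus \<Rightarrow> bool" where
  "abelian_variety n A \<longleftrightarrow> complex_torus n A \<and> (\<exists>c. ample A c)"

definition kaehler_domain :: "'v::real_normed_vector torus \<Rightarrow> ('v form \<times> 'v form) set" where
  "kaehler_domain A = NS_real A \<times> ample_cone A \<union> NS_real A \<times> uminus ` ample_cone A"

definition algebraic_pair ::
  "nat \<Rightarrow> 'v::real_normed_vector torus \<Rightarrow> 'v form \<times> 'v form \<Rightarrow> bool" where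
  "algebraic_pair n A \<omega> \<longleftrightarrow> abelian_variety n A \<and> \<omega> \<in> kaehler_domain A"

definition Q_form ::
  "'v::real_normed_vector \<times> ('v \<Rightarrow>\<^sub>L real) \<Rightarrow> 'v \<times> ('v \<Rightarrow>\<^sub>L real) \<Rightarrow> real" where
  "Q_form x y = snd x (fst y) + snd y (fst x)"

definition I_cstr ::
  "'v::real_normed_vector form \<times> 'v form \<Rightarrow> 'v \<times> ('v \<Rightarrow>\<^sub>L real) \<Rightarrow> 'v \<times> ('v \<Rightarrow>\<^sub>L real)" where
  "I_cstr \<omega> x =
     (let \<phi>1 = blinfun_apply (fst \<omega>); \<phi>2 = blinfun_apply (snd \<omega>); \<psi> = the_inv \<phi>2; (v, w) = x
      in (\<psi> (\<phi>1 v) - \<psi> w, \<phi>2 v + \<phi>1 (\<psi> (\<phi>1 v)) - \<phi>1 (\<psi> w)))"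

text \<open>An isomorphism of lattices \<open>\<Lambda>\<^sub>A \<rightarrow> \<Lambda>\<^sub>B\<close> is given by its unique real-linear
  extension \<open>\<alpha>\<close>.\<close>

definition mirror_symmetric ::
  "'a::real_normed_vector torus \<times> ('a form \<times> 'a form) \<Rightarrow>
   'b::real_normed_vector torus \<times> ('b form \<times> 'b form) \<Rightarrow> bool" where
  "mirror_symmetric P R \<longleftrightarrow>
     (let (A, \<omega>A) = P; (B, \<omega>B) = R;
          AA = prod_torus A (dual_torus A); BB = prod_torus B (dual_torus B)
      in \<exists>\<alpha>. linear \<alpha> \<and> bij \<alpha> \<and> \<alpha> ` periods AA = periods BB \<and>
           (\<forall>x\<in>periods AA. \<forall>y\<in>periods AA. Q_form (\<alpha> x) (\<alpha> y) = Q_form x y) \<and>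
           (\<forall>x. \<alpha> (cstr AA x) = I_cstr \<omega>B (\<alpha> x)) \<and>
           (\<forall>x. \<alpha> (I_cstr \<omega>A x) = cstr BB (\<alpha> x)))"

end

theory Submission
  imports Defs
begin

text \<open>Since \<open>NS\<close> has rank one, it is carried by one ample class \<open>c\<close>: every element of
  \<open>NS \<otimes> \<complex>\<close> is \<open>(a + ib) c\<close>, it is nondegenerate iff \<open>b \<noteq> 0\<close>, and the sign of \<open>b\<close> decides in
  which half of the domain it lies. This gives the first claim (\<open>kaehler_domain_rank_one\<close>).

  For the mirror, take \<open>\<omega> = (a + ib) c\<close> and a symplectic basis \<open>e\<^sub>i, f\<^sub>i\<close> of \<open>\<Gamma>\<close> with
  \<open>c(e\<^sub>i, f\<^sub>i) = d\<^sub>i > 0\<close> (\<open>symplectic_basis\<close>). As \<open>c e\<^sub>i = d\<^sub>i f\<^sub>i\<^sup>*\<close> and \<open>c f\<^sub>i = - d\<^sub>i e\<^sub>i\<^sup>*\<close>, the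
  complex structure \<open>I\<^sub>\<omega>\<close> preserves every plane \<open>\<langle>e\<^sub>i, f\<^sub>i\<^sup>*\<rangle>\<close> and every plane \<open>\<langle>f\<^sub>i, e\<^sub>i\<^sup>*\<rangle>\<close>. The
  former span a subspace \<open>W\<close>, the latter a subspace \<open>W'\<close>; both are isotropic for \<open>Q\<close>, so \<open>Q\<close>
  identifies \<open>W'\<close> and its lattice with the dual of \<open>W\<close>. Hence \<open>W\<close> with the restriction of
  \<open>I\<^sub>\<omega>\<close> is the product of the elliptic curves \<open>E\<^sub>i = \<langle>e\<^sub>i, f\<^sub>i\<^sup>*\<rangle>\<close>, and \<open>I\<^sub>\<omega>\<close> becomes the complex
  structure of \<open>E\<close> times its dual. In the basis \<open>e\<^sub>i, d\<^sub>i f\<^sub>i\<^sup>*\<close> the matrix of \<open>I\<^sub>\<omega>\<close> does not depend on \<open>i\<close>: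
  only the lattices \<open>\<int> \<oplus> d\<^sub>i\<^sup>-\<^sup>1 \<int>\<close> differ, so that the \<open>E\<^sub>i\<close> are isogenous.

  Conversely, \<open>J\<close> on \<open>V \<oplus> V\<^sup>*\<close> has to correspond to the complex structure of some class
  \<open>\<phi>\<^sub>1 + i \<phi>\<^sub>2\<close> on \<open>E\<close>. Identify \<open>V\<^sup>*\<close> with \<open>V\<close> by \<open>c\<close>; then \<open>J\<close> acts diagonally on \<open>V \<oplus> V = V \<otimes> \<real>\<^sup>2\<close> and \<open>W = \<real>\<^sup>n \<otimes> \<real>\<^sup>2\<close>, where
  \<open>\<real>\<^sup>n\<close> is the quotient of \<open>V\<close> by the Lagrangian subspace spanned by the \<open>f\<^sub>i\<close>. Reading off the
  blocks of \<open>J\<close> gives \<open>\<phi>\<^sub>1 = T \<otimes> det\<close> and \<open>\<phi>\<^sub>2 = R \<otimes> det\<close> with symmetric forms \<open>T\<close> and \<open>R\<close>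
  on \<open>\<real>\<^sup>n\<close>: here \<open>T + i R\<close> is the point of the Siegel upper half space that describes \<open>A\<close>, and \<open>R\<close> is
  positive definite because \<open>c\<close> is ample. All the forms \<open>S \<otimes> det\<close> with \<open>S\<close> symmetric lie in the
  real Neron-Severi space of \<open>E\<close>, since those with suitably divisible integral \<open>S\<close> are integral
  (\<open>det_form_in_NS_real\<close>), and \<open>R \<otimes> det\<close> is definite of the sign of \<open>b\<close>. Positive real
  classes are positive combinations of ample ones (\<open>positive_in_ample_cone\<close>), so \<open>E\<close> with the class \<open>\<phi>\<^sub>1 + i \<phi>\<^sub>2\<close> is an algebraic pair.\<close>

section \<open>Bilinear forms and full lattices\<close>

definition form_of :: "('v::euclidean_space \<Rightarrow> 'v \<Rightarrow> real) \<Rightarrow> 'v form" where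
  "form_of h = Blinfun (\<lambda>x. Blinfun (h x))"

lemma form_of_apply:
  fixes h :: "'v::euclidean_space \<Rightarrow> 'v \<Rightarrow> real"
  assumes "bilinear h"
  shows "form_of h x y = h x y"
proof -
  interpret h: bounded_bilinear h
    using assms bilinear_conv_bounded_bilinear by blast
  have inner: "Blinfun (h z) = h.prod_right z" for z
    by (rule blinfun_eqI) (simp add: h.prod_right.rep_eq bounded_linear_Blinfun_apply
        h.bounded_linear_right)
  have "bounded_linear (\<lambda>z. Blinfun (h z))"
    unfolding inner by (rule h.bounded_linear_prod_right)
  then show ?thesis
    by (simp add: form_of_def bounded_linear_Blinfun_apply inner h.prod_right.rep_eq)
qed

text \<open>Identifying the dual space with the space itself by the inner product turns \<open>c\<close> into an
  injective endomorphism of a finite-dimensional space.\<close>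

lemma nondegenerate_form_bij:
  fixes c :: "'v::euclidean_space form"
  assumes nondeg: "\<And>x. (\<And>y. c x y = 0) \<Longrightarrow> x = 0"
  shows "bij (blinfun_apply c)"
proof (rule bijI)
  have zero: "x = 0" if "c x = 0" for x
    using nondeg[of x] that by simp
  show "inj (blinfun_apply c)"
  proof (rule injI)
    fix x y assume "blinfun_apply c x = c y"
    then have "c (x - y) = 0" by (simp add: blinfun.diff_right)
    then show "x = y" using zero by force
  qed
  define r :: "('v \<Rightarrow>\<^sub>L real) \<Rightarrow> 'v" where "r w = (\<Sum>k\<in>Basis. w k *\<^sub>R k)" for w
  have r_inner: "r w \<bullet> x = w x" for w x
  proof -
    have "w x = w (\<Sum>k\<in>Basis. (x \<bullet> k) *\<^sub>R k)"
      by (simp add: euclidean_representation)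
    also have "\<dots> = r w \<bullet> x"
      by (simp add: r_def blinfun.sum_right blinfun.scaleR_right inner_sum_left
          inner_commute[of x] mult.commute)
    finally show ?thesis by simp
  qed
  have r_inj: "w = w'" if "r w = r w'" for w w'
    using r_inner[of w] r_inner[of w'] that by (intro blinfun_eqI) metis
  have lin: "linear (\<lambda>x. r (c x))"
    by (rule linearI)
      (simp_all add: r_def blinfun.add_right blinfun.scaleR_right blinfun.add_left
        blinfun.scaleR_left scaleR_add_left sum.distrib scaleR_sum_right)
  have "inj (\<lambda>x. r (c x))"
    using r_inj injD[OF \<open>inj (blinfun_apply c)\<close>] by (intro injI) blast
  then have "surj (\<lambda>x. r (c x))"
    using lin linear_injective_imp_surjective by blast
  then show "surj (blinfun_apply c)"
    using r_inj unfolding surj_def by metis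
qed

text \<open>Lattices are presented here by coordinate functions: if \<open>\<tau>\<close> is the dual basis of \<open>\<beta>\<close>,
  integrality of the coordinates is membership in the lattice spanned by \<open>\<beta>\<close>.\<close>

lemma full_latticeI:
  fixes \<beta> :: "'k \<Rightarrow> 'v::real_normed_vector" and \<tau> :: "'k \<Rightarrow> 'v \<Rightarrow> real"
  assumes fin: "finite K"
    and lin: "\<And>k. k \<in> K \<Longrightarrow> linear (\<tau> k)"
    and dual: "\<And>k l. k \<in> K \<Longrightarrow> l \<in> K \<Longrightarrow> \<tau> k (\<beta> l) = (if k = l then 1 else 0)"
    and expand: "\<And>x. x = (\<Sum>k\<in>K. \<tau> k x *\<^sub>R \<beta> k)"
  shows "full_lattice (card K) {x. \<forall>k\<in>K. \<tau> k x \<in> \<int>}"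
proof -
  have inj: "inj_on \<beta> K"
    by (rule inj_onI) (metis dual zero_neq_one)
  have coord: "\<tau> k (\<Sum>l\<in>K. q l *\<^sub>R \<beta> l) = q k" if "k \<in> K" for k q
  proof -
    have "\<tau> k (\<Sum>l\<in>K. q l *\<^sub>R \<beta> l) = (\<Sum>l\<in>K. if k = l then q l else 0)"
      using that lin by (simp add: linear_sum linear_scale dual if_distrib cong: if_cong sum.cong)
    then show ?thesis using fin that by simp
  qed
  have sums: "(\<Sum>x\<in>\<beta> ` K. q x *\<^sub>R x) = (\<Sum>k\<in>K. q (\<beta> k) *\<^sub>R \<beta> k)" for q
    by (simp add: sum.reindex[OF inj])
  have indep: "independent (\<beta> ` K)"
  proof (rule independent_if_scalars_zero)
    fix q x assume "(\<Sum>x\<in>\<beta> ` K. q x *\<^sub>R x) = 0" and x: "x \<in> \<beta> ` K"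
    then have "(\<Sum>k\<in>K. q (\<beta> k) *\<^sub>R \<beta> k) = 0" by (simp add: sums)
    then show "q x = 0"
      using x coord[of _ "q \<circ> \<beta>"] lin linear_0 by fastforce
  qed (use fin in simp)
  have "x \<in> span (\<beta> ` K)" for x
    by (subst expand[of x]) (intro span_sum span_scale span_base imageI)
  then have span: "span (\<beta> ` K) = UNIV" by auto
  have "{x. \<forall>k\<in>K. \<tau> k x \<in> \<int>} = {\<Sum>x\<in>\<beta> ` K. real_of_int (n x) *\<^sub>R x | n. True}" (is "?L = ?R")
  proof (intro equalityI subsetI)
    fix x assume x: "x \<in> ?L"
    define n where "n y = \<lfloor>\<tau> (inv_into K \<beta> y) x\<rfloor>" for y
    have "real_of_int (n (\<beta> k)) = \<tau> k x" if "k \<in> K" for k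
      using that x inj by (auto simp: n_def elim: Ints_cases)
    then have "x = (\<Sum>y\<in>\<beta> ` K. real_of_int (n y) *\<^sub>R y)"
      unfolding sums by (subst expand[of x]) (auto intro: sum.cong)
    then show "x \<in> ?R" by blast
  next
    fix x assume "x \<in> ?R"
    then obtain n where "x = (\<Sum>k\<in>K. real_of_int (n (\<beta> k)) *\<^sub>R \<beta> k)"
      unfolding sums by auto
    then show "x \<in> ?L" using coord[of _ "\<lambda>k. real_of_int (n (\<beta> k))"] by simp
  qed
  then show ?thesis
    unfolding full_lattice_def
    by (intro exI[of _ "\<beta> ` K"]) (simp add: fin indep span card_image[OF inj])
qed

lemma full_lattice_rank:
  fixes L :: "'v::euclidean_space set"
  assumes "full_lattice r L" shows "r = DIM('v)"
proof -
  obtain B :: "'v set" where "card B = r" "independent B" "span B = UNIV"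
    using assms by (auto simp: full_lattice_def)
  then show ?thesis using dim_eq_card[of B UNIV] by simp
qed

lemma full_lattice_span:
  fixes L :: "'v::euclidean_space set"
  assumes "full_lattice r L" shows "span L = UNIV"
proof -
  obtain B where B: "finite B" "span B = UNIV"
      "L = {\<Sum>b\<in>B. real_of_int (k b) *\<^sub>R b | k. True}"
    using assms by (auto simp: full_lattice_def)
  have "b \<in> L" if "b \<in> B" for b
  proof -
    have "b = (\<Sum>x\<in>B. real_of_int (if x = b then 1 else 0) *\<^sub>R x)"
      using that B(1) by (simp add: if_distrib if_distribR cong: if_cong)
    then show ?thesis unfolding B(3) by (intro CollectI exI[of _ "\<lambda>x. if x = b then 1 else 0"]) simp
  qed
  then show ?thesis using B(2) span_mono[of B L] by auto
qed

lemma full_lattice_diff: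
  assumes "full_lattice r L" "x \<in> L" "y \<in> L" shows "x - y \<in> L"
proof -
  obtain B k l where B: "L = {\<Sum>b\<in>B. real_of_int (k b) *\<^sub>R b | k. True}"
      "x = (\<Sum>b\<in>B. real_of_int (k b) *\<^sub>R b)" "y = (\<Sum>b\<in>B. real_of_int (l b) *\<^sub>R b)"
    using assms by (auto simp: full_lattice_def)
  have "x - y = (\<Sum>b\<in>B. real_of_int (k b - l b) *\<^sub>R b)"
    by (simp add: B(2,3) sum_subtractf scaleR_diff_left)
  then show ?thesis unfolding B(1) by (intro CollectI exI[of _ "\<lambda>b. k b - l b"]) simp
qed

lemma full_lattice_zero:
  assumes "full_lattice r L" shows "0 \<in> L"
proof -
  obtain B where B: "L = {\<Sum>b\<in>B. real_of_int (k b) *\<^sub>R b | k. True}"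
    using assms by (auto simp: full_lattice_def)
  show ?thesis unfolding B by (intro CollectI exI[of _ "\<lambda>_. 0"]) simp
qed

section \<open>The ample cone\<close>

text \<open>This is ampleness without integrality: positivity of the associated Hermitian form.\<close>

definition positive_form :: "'v::real_normed_vector torus \<Rightarrow> 'v form \<Rightarrow> bool" where
  "positive_form A h \<longleftrightarrow> (\<forall>v. v \<noteq> 0 \<longrightarrow> h v (cstr A v) > 0)"

lemma NS_I:
  fixes c :: "'v::real_normed_vector form"
  assumes "\<And>x y. c x y = - c y x"
    and "\<And>x y. x \<in> periods A \<Longrightarrow> y \<in> periods A \<Longrightarrow> c x y \<in> \<int>"
    and "\<And>x y. c (cstr A x) (cstr A y) = c x y"
  shows "c \<in> NS A"
  using assms unfolding NS_def by blast

lemma NS_D: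
  fixes c :: "'v::real_normed_vector form"
  assumes "c \<in> NS A"
  shows NS_skew: "c x y = - c y x"
    and NS_integral: "x \<in> periods A \<Longrightarrow> y \<in> periods A \<Longrightarrow> c x y \<in> \<int>"
    and NS_invariant: "c (cstr A x) (cstr A y) = c x y"
  using assms unfolding NS_def by blast+

lemma NS_add:
  assumes "c \<in> NS A" "c' \<in> NS A" shows "c + c' \<in> NS A"
proof (rule NS_I)
  show "(c + c') x y = - (c + c') y x" for x y
    using NS_skew[OF assms(1), of x y] NS_skew[OF assms(2), of x y] by (simp add: blinfun.add_left)
qed (simp_all add: blinfun.add_left NS_integral[OF assms(1)] NS_integral[OF assms(2)]
    NS_invariant[OF assms(1)] NS_invariant[OF assms(2)])

lemma NS_of_int_scale:
  assumes "c \<in> NS A" shows "of_int k *\<^sub>R c \<in> NS A"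
proof (rule NS_I)
  show "(of_int k *\<^sub>R c) x y = - (of_int k *\<^sub>R c) y x" for x y
    using NS_skew[OF assms, of x y] by (simp add: blinfun.scaleR_left)
qed (simp_all add: blinfun.scaleR_left NS_integral[OF assms] NS_invariant[OF assms])

lemma ample_cone_scale:
  assumes "h \<in> ample_cone A" "t > 0" shows "t *\<^sub>R h \<in> ample_cone A"
proof -
  obtain S r where S: "h = (\<Sum>c\<in>S. r c *\<^sub>R c)" "finite S" "S \<noteq> {}" "\<forall>c\<in>S. ample A c \<and> r c > 0"
    using assms by (auto simp: ample_cone_def)
  have "t *\<^sub>R h = (\<Sum>c\<in>S. (t * r c) *\<^sub>R c)" by (simp add: S(1) scaleR_sum_right)
  then show ?thesis
    unfolding ample_cone_def using S assms(2)
    by (intro CollectI exI[of _ S] exI[of _ "\<lambda>c. t * r c"]) auto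
qed

lemma ample_cone_add:
  assumes "h \<in> ample_cone A" "h' \<in> ample_cone A" shows "h + h' \<in> ample_cone A"
proof -
  obtain S r where S: "h = (\<Sum>c\<in>S. r c *\<^sub>R c)" "finite S" "S \<noteq> {}" "\<forall>c\<in>S. ample A c \<and> r c > 0"
    using assms by (auto simp: ample_cone_def)
  obtain S' r' where S': "h' = (\<Sum>c\<in>S'. r' c *\<^sub>R c)" "finite S'" "\<forall>c\<in>S'. ample A c \<and> r' c > 0"
    using assms by (auto simp: ample_cone_def)
  define s where "s c = (if c \<in> S then r c else 0) + (if c \<in> S' then r' c else 0)" for c
  have "(\<Sum>c\<in>S \<union> S'. s c *\<^sub>R c)
      = (\<Sum>c\<in>S \<union> S'. (if c \<in> S then r c *\<^sub>R c else 0)) + (\<Sum>c\<in>S \<union> S'. (if c \<in> S' then r' c *\<^sub>R c else 0))"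
    unfolding sum.distrib[symmetric] by (rule sum.cong) (auto simp: s_def scaleR_add_left)
  also have "\<dots> = h + h'"
    unfolding S(1) S'(1) using S(2) S'(2)
    by (intro arg_cong2[where f="(+)"]; intro sum.mono_neutral_cong_right) auto
  finally show ?thesis
    unfolding ample_cone_def using S S'
    by (intro CollectI exI[of _ "S \<union> S'"] exI[of _ s]) (auto simp: s_def add_pos_pos)
qed

lemma ample_scale_in_ample_cone:
  assumes "ample A c" "t > 0" shows "t *\<^sub>R c \<in> ample_cone A"
  unfolding ample_cone_def using assms
  by (intro CollectI exI[of _ "{c}"] exI[of _ "\<lambda>_. t"]) auto

text \<open>By compactness of the unit sphere, \<open>h(v, Jv)\<close> dominates a positive multiple of \<open>|v|\<^sup>2\<close>,
  whereas \<open>g(v, Jv)\<close> is bounded by a multiple of it.\<close>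

lemma positive_form_open:
  fixes A :: "'v::euclidean_space torus"
  assumes "positive_form A h"
  obtains \<epsilon> where "\<epsilon> > 0" "\<And>t. \<bar>t\<bar> < \<epsilon> \<Longrightarrow> positive_form A (h + t *\<^sub>R g)"
proof -
  let ?J = "cstr A"
  have cont: "continuous_on (sphere 0 1) (\<lambda>v. h v (?J v))"
    by (intro continuous_intros)
  have ne: "sphere (0::'v) 1 \<noteq> {}" by simp
  obtain u where u: "u \<in> sphere 0 1" "\<And>v. v \<in> sphere 0 1 \<Longrightarrow> h u (?J u) \<le> h v (?J v)"
    using continuous_attains_inf[OF compact_sphere ne cont] by blast
  define m where "m = h u (?J u)"
  have "u \<noteq> 0" using u(1) by auto
  then have m: "m > 0" using assms by (simp add: m_def positive_form_def)
  define M where "M = norm g * norm ?J + 1"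
  have M: "M > 0" by (simp add: M_def add_nonneg_pos)
  have "positive_form A (h + t *\<^sub>R g)" if t: "\<bar>t\<bar> < m / M" for t
    unfolding positive_form_def
  proof (intro allI impI)
    fix v :: 'v assume v: "v \<noteq> 0"
    have "m \<le> h (v /\<^sub>R norm v) (?J (v /\<^sub>R norm v))"
      unfolding m_def by (rule u(2)) (use v in simp)
    also have "\<dots> = h v (?J v) / (norm v)\<^sup>2"
      by (simp add: blinfun.scaleR_right blinfun.scaleR_left power2_eq_square field_simps)
    finally have lower: "m * (norm v)\<^sup>2 \<le> h v (?J v)"
      using v by (simp add: field_simps)
    have "norm (g v (?J v)) \<le> norm (g v) * norm (?J v)" by (rule norm_blinfun)
    also have "\<dots> \<le> (norm g * norm v) * (norm ?J * norm v)"
      by (intro mult_mono norm_blinfun) auto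
    also have "\<dots> \<le> M * (norm v)\<^sup>2"
      by (simp add: M_def power2_eq_square algebra_simps)
    finally have "\<bar>t * g v (?J v)\<bar> \<le> \<bar>t\<bar> * (M * (norm v)\<^sup>2)"
      by (simp add: abs_mult mult_left_mono)
    also have "\<dots> < m / M * (M * (norm v)\<^sup>2)"
      using t M v by (intro mult_strict_right_mono) auto
    also have "\<dots> = m * (norm v)\<^sup>2" using M by simp
    finally show "(h + t *\<^sub>R g) v (?J v) > 0"
      using lower by (simp add: blinfun.add_left blinfun.scaleR_left)
  qed
  then show ?thesis using that[of "m / M"] m M by simp
qed

text \<open>A positive real class is a convex combination of positive classes with one more rational
  coefficient, because positivity survives moving the coefficient \<open>x g\<close> to rational values on either
  side of it. Once all coefficients are rational the class is a positive multiple of an ample one.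
  The rational part collected so far is kept as \<open>c / N\<close> with \<open>c\<close> integral.\<close>

lemma positive_combination_in_ample_cone:
  fixes A :: "'v::euclidean_space torus"
  assumes "finite T" "T \<subseteq> NS A" "c \<in> NS A" "N > 0"
    and "positive_form A (c /\<^sub>R real N + (\<Sum>h\<in>T. x h *\<^sub>R h))"
  shows "c /\<^sub>R real N + (\<Sum>h\<in>T. x h *\<^sub>R h) \<in> ample_cone A"
  using assms
proof (induction T arbitrary: c N rule: finite_induct)
  case empty
  have "ample A c"
    using empty.prems by (auto simp: ample_def positive_form_def blinfun.scaleR_left zero_less_mult_iff)
  then show ?case using empty.prems ample_scale_in_ample_cone[of A c "inverse (real N)"] by simp
next
  case (insert g T)
  let ?s = "\<Sum>h\<in>T. x h *\<^sub>R h"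
  let ?p = "\<lambda>y. c /\<^sub>R real N + y *\<^sub>R g + ?s"
  have eq: "c /\<^sub>R real N + (\<Sum>h\<in>insert g T. x h *\<^sub>R h) = ?p (x g)"
    using insert.hyps by simp
  obtain \<epsilon> where \<epsilon>: "\<epsilon> > 0" "\<And>t. \<bar>t\<bar> < \<epsilon> \<Longrightarrow> positive_form A (?p (x g) + t *\<^sub>R g)"
    using positive_form_open insert.prems(4) unfolding eq by blast
  have pos: "positive_form A (?p y)" if "\<bar>y - x g\<bar> < \<epsilon>" for y
    using \<epsilon>(2)[OF that] by (simp add: algebra_simps)
  have rational: "?p y \<in> ample_cone A" if y: "y \<in> \<rat>" "\<bar>y - x g\<bar> < \<epsilon>" for y
  proof -
    obtain k M where M: "M > 0" "y = of_int k / of_int M"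
      using y(1) by (auto elim: Rats_cases')
    define c' where "c' = of_int M *\<^sub>R c + of_int (k * int N) *\<^sub>R g"
    have "c' /\<^sub>R real (nat M * N) = c /\<^sub>R real N + y *\<^sub>R g"
      using M insert.prems(3) by (simp add: c'_def scaleR_add_right field_simps)
    moreover have "c' \<in> NS A"
      unfolding c'_def using insert.prems by (intro NS_add NS_of_int_scale) auto
    ultimately show ?thesis
      using insert.IH[of c' "nat M * N"] insert.prems M(1) pos[OF y(2)] by simp
  qed
  obtain p where p: "p \<in> \<rat>" "x g - \<epsilon> < p" "p < x g"
    using Rats_dense_in_real[of "x g - \<epsilon>" "x g"] \<epsilon>(1) by auto
  obtain q where q: "q \<in> \<rat>" "x g < q" "q < x g + \<epsilon>"
    using Rats_dense_in_real[of "x g" "x g + \<epsilon>"] \<epsilon>(1) by auto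
  \<comment> \<open>the weights with which \<open>x g\<close> is a convex combination of \<open>p\<close> and \<open>q\<close>\<close>
  define s where "s = (x g - p) / (q - p)"
  have s: "s > 0" "1 - s > 0" using p q by (auto simp: s_def field_simps)
  have xg: "x g = (1 - s) * p + s * q"
  proof -
    have "s * (q - p) = x g - p" using p q by (simp add: s_def)
    then show ?thesis by (simp add: algebra_simps)
  qed
  have "w + ((1 - s) * p + s * q) *\<^sub>R g = (1 - s) *\<^sub>R (w + p *\<^sub>R g) + s *\<^sub>R (w + q *\<^sub>R g)" for w
    by (simp add: algebra_simps)
  from this[of "c /\<^sub>R real N + ?s"] have "?p (x g) = (1 - s) *\<^sub>R ?p p + s *\<^sub>R ?p q"
    by (simp add: xg ac_simps)
  moreover have "?p p \<in> ample_cone A" "?p q \<in> ample_cone A"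
    using rational p q by auto
  ultimately show ?case
    unfolding eq using s by (simp only: ample_cone_add ample_cone_scale)
qed

lemma positive_in_ample_cone:
  fixes A :: "'v::euclidean_space torus"
  assumes "h \<in> NS_real A" "positive_form A h"
  shows "h \<in> ample_cone A"
proof -
  obtain T x where T: "finite T" "T \<subseteq> NS A" "h = (\<Sum>g\<in>T. x g *\<^sub>R g)"
    using assms(1) unfolding NS_real_def span_explicit by blast
  have "(0 :: 'v form) \<in> NS A" by (rule NS_I) simp_all
  then show ?thesis
    using positive_combination_in_ample_cone[OF T(1,2), of 0 1 x] assms(2) T(3) by simp
qed

lemma ample_cone_nonempty: "h \<in> ample_cone A \<Longrightarrow> \<exists>c. ample A c"
  by (auto simp: ample_cone_def)

section \<open>Symplectic bases of integral forms\<close>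

lemma int_multiple_mem:
  fixes G :: "'v::real_vector set"
  assumes "0 \<in> G" "\<And>x y. x \<in> G \<Longrightarrow> y \<in> G \<Longrightarrow> x - y \<in> G" "x \<in> G"
  shows "of_int k *\<^sub>R x \<in> G"
proof (induction k rule: int_induct[where k = 0])
  case base show ?case using assms by simp
next
  case (step1 i)
  have "of_int (i + 1) *\<^sub>R x = of_int i *\<^sub>R x - (0 - x)" by (simp add: scaleR_add_left)
  then show ?case using step1 assms by metis
next
  case (step2 i)
  have "of_int (i - 1) *\<^sub>R x = of_int i *\<^sub>R x - x" by (simp add: scaleR_diff_left)
  then show ?case using step2 assms by metis
qed

lemma dim_less_of_functional:
  fixes G G' :: "'v::euclidean_space set"
  assumes "G' \<subseteq> G" "x \<in> G" "linear h" "h x \<noteq> (0::real)" "\<And>y. y \<in> G' \<Longrightarrow> h y = 0"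
  shows "dim G' < dim G"
proof -
  have "span G' \<subseteq> {y. h y = 0}"
    using assms(3,5) by (intro span_minimal) (auto simp: linear_subspace_kernel)
  then have "x \<notin> span G'" using assms(4) by auto
  then have "dim (insert x G') = Suc (dim G')" by (simp add: dim_insert)
  moreover have "dim (insert x G') \<le> dim G"
    using assms(1,2) by (intro dim_subset) auto
  ultimately show ?thesis by simp
qed

text \<open>Frobenius' normal form of an integral alternating form. Let \<open>n\<close> be its least positive value,
  attained at \<open>e\<^sub>0, f\<^sub>0\<close>. Division with remainder shows that \<open>n\<close> divides all values \<open>c(x, f\<^sub>0)\<close> and
  \<open>c(e\<^sub>0, x)\<close>, so that \<open>G\<close> splits into \<open>\<int> e\<^sub>0 + \<int> f\<^sub>0\<close> and its orthogonal complement, which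
  has smaller dimension. The length \<open>m\<close> comes out of the induction and is identified later
  from the dimension of the whole space.\<close>

lemma symplectic_basis_nat:
  fixes c :: "'v::euclidean_space form"
  assumes skew: "\<And>x y. c x y = - c y x"
    and zero: "0 \<in> G" and diff: "\<And>x y. x \<in> G \<Longrightarrow> y \<in> G \<Longrightarrow> x - y \<in> G"
    and int: "\<And>x y. x \<in> G \<Longrightarrow> y \<in> G \<Longrightarrow> c x y \<in> \<int>"
    and nondeg: "\<And>x. x \<in> G \<Longrightarrow> (\<And>y. y \<in> G \<Longrightarrow> c x y = 0) \<Longrightarrow> x = 0"
  shows "\<exists>(m::nat) e f (d :: nat \<Rightarrow> int).
    (\<forall>i<m. e i \<in> G \<and> f i \<in> G \<and> d i > 0) \<and>
    (\<forall>i<m. \<forall>j<m. c (e i) (e j) = 0 \<and> c (f i) (f j) = 0 \<and>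
        c (e i) (f j) = (if i = j then of_int (d i) else 0)) \<and>
    (\<forall>x\<in>G. x = (\<Sum>i<m. (c x (f i) / of_int (d i)) *\<^sub>R e i + (c (e i) x / of_int (d i)) *\<^sub>R f i)) \<and>
    (\<forall>x\<in>G. \<forall>i<m. c x (f i) / of_int (d i) \<in> \<int> \<and> c (e i) x / of_int (d i) \<in> \<int>)"
  using zero diff int nondeg
proof (induction "dim G" arbitrary: G rule: less_induct)
  case (less G)
  note zero = less.prems(1) and diff = less.prems(2) and int = less.prems(3)
    and nondeg = less.prems(4)
  have self: "c x x = 0" for x using skew[of x x] by simp
  have mult: "of_int k *\<^sub>R x \<in> G" if "x \<in> G" for k x
    using int_multiple_mem zero diff that by blast
  show ?case
  proof (cases "G = {0}")
    case True
    then show ?thesis by (intro exI[of _ 0]) auto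
  next
    case False
    then obtain x0 where "x0 \<in> G" "x0 \<noteq> 0" using zero by auto
    then obtain y0 where y0: "y0 \<in> G" "c x0 y0 \<noteq> 0" using nondeg by blast
    define P where "P n \<longleftrightarrow> n > 0 \<and> (\<exists>x\<in>G. \<exists>y\<in>G. c x y = real n)" for n
    have "\<exists>n. P n"
    proof -
      obtain k where k: "c x0 y0 = of_int k"
        using int[OF \<open>x0 \<in> G\<close> y0(1)] by (auto elim: Ints_cases)
      have "c x0 y0 = real (nat \<bar>k\<bar>) \<or> c y0 x0 = real (nat \<bar>k\<bar>)"
        using k skew[of y0 x0] by auto
      moreover have "nat \<bar>k\<bar> > 0" using k y0 by simp
      ultimately have "P (nat \<bar>k\<bar>)" unfolding P_def using \<open>x0 \<in> G\<close> y0(1) by blast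
      then show ?thesis by blast
    qed
    define n where "n = (LEAST n. P n)"
    have "P n" unfolding n_def using \<open>\<exists>n. P n\<close> by (rule LeastI_ex)
    then obtain e0 f0 where ef: "e0 \<in> G" "f0 \<in> G" "c e0 f0 = real n" and n: "n > 0"
      by (auto simp: P_def)
    \<comment> \<open>a remainder modulo \<open>n\<close> that is a value of \<open>c\<close> vanishes\<close>
    have minimal: "k = 0" if "x \<in> G" "y \<in> G" "c x y = of_int k" "0 \<le> k" "k < int n" for x y k
    proof (rule ccontr)
      assume "k \<noteq> 0"
      then have "P (nat k)" using that by (auto simp: P_def)
      then show False using that not_less_Least[of "nat k" P] by (simp add: n_def[symmetric])
    qed
    have div_f: "c x f0 / real n \<in> \<int>" if x: "x \<in> G" for x
    proof -
      obtain k where k: "c x f0 = of_int k" using int[OF x ef(2)] by (auto elim: Ints_cases)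
      have "c (x - of_int (k div int n) *\<^sub>R e0) f0 = of_int (k - k div int n * int n)"
        by (simp add: k ef(3) blinfun.bilinear_simps)
      also have "k - k div int n * int n = k mod int n" by (rule minus_div_mult_eq_mod)
      finally have "k mod int n = 0"
        using minimal[OF diff[OF x mult[OF ef(1)]] ef(2)] n by simp
      then show ?thesis using k n by (auto simp: mod_eq_0_iff_dvd elim!: dvdE)
    qed
    have div_e: "c e0 x / real n \<in> \<int>" if x: "x \<in> G" for x
    proof -
      obtain k where k: "c e0 x = of_int k" using int[OF ef(1) x] by (auto elim: Ints_cases)
      have "c e0 (x - of_int (k div int n) *\<^sub>R f0) = of_int (k - k div int n * int n)"
        by (simp add: k ef(3) blinfun.bilinear_simps)
      also have "k - k div int n * int n = k mod int n" by (rule minus_div_mult_eq_mod)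
      finally have "k mod int n = 0"
        using minimal[OF ef(1) diff[OF x mult[OF ef(2)]]] n by simp
      then show ?thesis using k n by (auto simp: mod_eq_0_iff_dvd elim!: dvdE)
    qed
    define G' where "G' = {x \<in> G. c e0 x = 0 \<and> c x f0 = 0}"
    \<comment> \<open>the projection of \<open>G\<close> onto the orthogonal complement of \<open>e\<^sub>0\<close> and \<open>f\<^sub>0\<close>\<close>
    define \<pi> where "\<pi> x = x - ((c x f0 / real n) *\<^sub>R e0 + (c e0 x / real n) *\<^sub>R f0)" for x
    have split: "x = \<pi> x + ((c x f0 / real n) *\<^sub>R e0 + (c e0 x / real n) *\<^sub>R f0)" for x
      by (simp add: \<pi>_def)
    have \<pi>_mem: "\<pi> x \<in> G'" if x: "x \<in> G" for x
    proof -
      obtain k l where kl: "c x f0 / real n = of_int k" "c e0 x / real n = of_int l"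
        using div_f[OF x] div_e[OF x] by (auto elim!: Ints_cases)
      have "\<pi> x = x - of_int k *\<^sub>R e0 - of_int l *\<^sub>R f0" by (simp add: \<pi>_def kl)
      then have "\<pi> x \<in> G" using x ef diff mult by simp
      then show ?thesis
        using n by (simp add: G'_def \<pi>_def blinfun.bilinear_simps self ef(3))
    qed
    have perp: "c f0 x = 0" "c x e0 = 0" "c e0 x = 0" "c x f0 = 0" if "x \<in> G'" for x
      using that skew[of f0 x] skew[of x e0] by (auto simp: G'_def)
    have "dim G' < dim G"
      by (rule dim_less_of_functional[of _ _ e0 "\<lambda>x. c x f0"])
        (use ef n in \<open>auto simp: G'_def blinfun.bilinear_simps intro!: linearI\<close>)
    moreover have "0 \<in> G'" using zero by (simp add: G'_def)
    moreover have "x - y \<in> G'" if "x \<in> G'" "y \<in> G'" for x y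
      using that diff by (simp add: G'_def blinfun.bilinear_simps)
    moreover have "c x y \<in> \<int>" if "x \<in> G'" "y \<in> G'" for x y
      using that int by (simp add: G'_def)
    moreover have "x = 0" if x: "x \<in> G'" and perp': "\<And>y. y \<in> G' \<Longrightarrow> c x y = 0" for x
    proof (rule nondeg)
      show "x \<in> G" using x by (simp add: G'_def)
      fix y assume "y \<in> G"
      then show "c x y = 0"
        by (subst split[of y])
          (simp add: blinfun.bilinear_simps perp[OF x] perp'[OF \<pi>_mem])
    qed
    ultimately obtain m e f and d :: "nat \<Rightarrow> int" where
      mem: "\<forall>i<m. e i \<in> G' \<and> f i \<in> G' \<and> d i > 0" and
      rel: "\<forall>i<m. \<forall>j<m. c (e i) (e j) = 0 \<and> c (f i) (f j) = 0 \<and>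
        c (e i) (f j) = (if i = j then of_int (d i) else 0)" and
      expand: "\<forall>x\<in>G'. x = (\<Sum>i<m. (c x (f i) / of_int (d i)) *\<^sub>R e i + (c (e i) x / of_int (d i)) *\<^sub>R f i)" and
      ints: "\<forall>x\<in>G'. \<forall>i<m. c x (f i) / of_int (d i) \<in> \<int> \<and> c (e i) x / of_int (d i) \<in> \<int>"
      using less.hyps[of G'] by blast
    have proj: "c (\<pi> x) (f i) = c x (f i)" "c (e i) (\<pi> x) = c (e i) x" if "i < m" for x i
      using mem that perp[of "f i"] perp[of "e i"]
      by (simp_all add: \<pi>_def blinfun.bilinear_simps)
    let ?e = "e(m := e0)" and ?f = "f(m := f0)" and ?d = "d(m := int n)"
    have G'G: "G' \<subseteq> G" by (auto simp: G'_def)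
    show ?thesis
    proof (rule exI[of _ "Suc m"], rule exI[of _ ?e], rule exI[of _ ?f], rule exI[of _ ?d],
        intro conjI)
      show "\<forall>i<Suc m. ?e i \<in> G \<and> ?f i \<in> G \<and> ?d i > 0"
        using mem G'G ef n by (auto simp: less_Suc_eq)
      show "\<forall>i<Suc m. \<forall>j<Suc m. c (?e i) (?e j) = 0 \<and> c (?f i) (?f j) = 0 \<and>
        c (?e i) (?f j) = (if i = j then of_int (?d i) else 0)"
        using mem rel perp ef(3) self by (auto simp: less_Suc_eq)
      show "\<forall>x\<in>G. x = (\<Sum>i<Suc m. (c x (?f i) / of_int (?d i)) *\<^sub>R ?e i + (c (?e i) x / of_int (?d i)) *\<^sub>R ?f i)"
      proof
        fix x assume "x \<in> G"
        then have "\<pi> x = (\<Sum>i<m. (c (\<pi> x) (f i) / of_int (d i)) *\<^sub>R e i + (c (e i) (\<pi> x) / of_int (d i)) *\<^sub>R f i)"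
          using expand \<pi>_mem by blast
        also have "\<dots> = (\<Sum>i<m. (c x (f i) / of_int (d i)) *\<^sub>R e i + (c (e i) x / of_int (d i)) *\<^sub>R f i)"
          by (simp add: proj)
        finally show "x = (\<Sum>i<Suc m. (c x (?f i) / of_int (?d i)) *\<^sub>R ?e i + (c (?e i) x / of_int (?d i)) *\<^sub>R ?f i)"
          using split[of x] by simp
      qed
      show "\<forall>x\<in>G. \<forall>i<Suc m. c x (?f i) / of_int (?d i) \<in> \<int> \<and> c (?e i) x / of_int (?d i) \<in> \<int>"
      proof (intro ballI allI impI)
        fix x i assume x: "x \<in> G" and i: "i < Suc m"
        show "c x (?f i) / of_int (?d i) \<in> \<int> \<and> c (?e i) x / of_int (?d i) \<in> \<int>"
        proof (cases "i = m")
          case True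
          then show ?thesis using div_f[OF x] div_e[OF x] by simp
        next
          case False
          then have "i < m" using i by simp
          then show ?thesis using ints \<pi>_mem[OF x] proj[of i x] False by fastforce
        qed
      qed
    qed
  qed
qed


text \<open>The coordinates in the basis \<open>e, f\<close> are values of \<open>c\<close>, so the expansion extends from \<open>G\<close> to the
  whole space, and counting dimensions shows that the basis can be indexed by \<open>'n\<close>.\<close>

lemma symplectic_basis:
  fixes c :: "'v::euclidean_space form"
  assumes lattice: "full_lattice (2 * CARD('n::finite)) G"
    and skew: "\<And>x y. c x y = - c y x"
    and int: "\<And>x y. x \<in> G \<Longrightarrow> y \<in> G \<Longrightarrow> c x y \<in> \<int>"
    and nondeg: "\<And>x. (\<And>y. c x y = 0) \<Longrightarrow> x = 0"
  obtains e f :: "'n::finite \<Rightarrow> 'v" and d :: "'n \<Rightarrow> int"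
  where "\<And>i. d i > 0"
    and "\<And>i j. c (e i) (e j) = 0" "\<And>i j. c (f i) (f j) = 0"
    and "\<And>i j. c (e i) (f j) = (if i = j then of_int (d i) else 0)"
    and "\<And>x. x = (\<Sum>i\<in>UNIV. (c x (f i) / of_int (d i)) *\<^sub>R e i + (c (e i) x / of_int (d i)) *\<^sub>R f i)"
    and "\<And>x. x \<in> G \<longleftrightarrow> (\<forall>i. c x (f i) / of_int (d i) \<in> \<int> \<and> c (e i) x / of_int (d i) \<in> \<int>)"
proof -
  note zero = full_lattice_zero[OF lattice] and diff = full_lattice_diff[OF lattice]
    and span = full_lattice_span[OF lattice]
  have nondeg_G: "x = 0" if "\<And>y. y \<in> G \<Longrightarrow> c x y = 0" for x
  proof (rule nondeg)
    fix y
    have "y \<in> span G" by (simp add: span)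
    then show "c x y = 0"
      by (rule linear_eq_0_on_span[rotated 2]) (auto simp: that intro: bounded_linear.linear blinfun.bounded_linear_right)
  qed
  obtain m :: nat and e f and d :: "nat \<Rightarrow> int" where
    mem: "\<forall>i<m. e i \<in> G \<and> f i \<in> G \<and> d i > 0" and
    rel: "\<forall>i<m. \<forall>j<m. c (e i) (e j) = 0 \<and> c (f i) (f j) = 0 \<and>
        c (e i) (f j) = (if i = j then of_int (d i) else 0)" and
    expand_G: "\<forall>x\<in>G. x = (\<Sum>i<m. (c x (f i) / of_int (d i)) *\<^sub>R e i + (c (e i) x / of_int (d i)) *\<^sub>R f i)" and
    ints: "\<forall>x\<in>G. \<forall>i<m. c x (f i) / of_int (d i) \<in> \<int> \<and> c (e i) x / of_int (d i) \<in> \<int>"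
    using symplectic_basis_nat[OF skew zero diff int] nondeg_G by blast
  let ?S = "\<lambda>x. \<Sum>i<m. (c x (f i) / of_int (d i)) *\<^sub>R e i + (c (e i) x / of_int (d i)) *\<^sub>R f i"
  have expand: "x = ?S x" for x
  proof -
    have "linear ?S"
      by (intro linear_compose_sum ballI linearI)
        (simp_all add: blinfun.bilinear_simps
          add_divide_distrib scaleR_add_left scaleR_add_right)
    moreover have "x \<in> span G" by (simp add: span)
    ultimately show ?thesis
      using linear_eq_on_span[OF linear_ident _ expand_G[rule_format]] by blast
  qed
  have "m = CARD('n)"
  proof -
    let ?K = "{..<m} \<times> (UNIV :: bool set)"
    let ?\<beta> = "\<lambda>(i, t). if t then e i else f i"
    let ?\<tau> = "\<lambda>(i, t) x. if t then c x (f i) / of_int (d i) else c (e i) x / of_int (d i)"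
    have "full_lattice (card ?K) {x. \<forall>k\<in>?K. ?\<tau> k x \<in> \<int>}"
    proof (rule full_latticeI[where \<beta> = ?\<beta>])
      show "linear (?\<tau> k)" for k
        by (cases k) (auto intro!: linearI simp: blinfun.bilinear_simps add_divide_distrib)
      show "?\<tau> k (?\<beta> l) = (if k = l then 1 else 0)" if "k \<in> ?K" "l \<in> ?K" for k l
      proof -
        obtain i s j t where kl: "k = (i, s)" "l = (j, t)" by (cases k, cases l) auto
        then have ij: "i < m" "j < m" using that by auto
        then have "d i \<noteq> 0" using mem by force
        then show ?thesis
          using rel[rule_format, OF ij] rel[rule_format, OF ij(2,1)] kl by (cases s; cases t) auto
      qed
      show "x = (\<Sum>k\<in>?K. ?\<tau> k x *\<^sub>R ?\<beta> k)" for x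
        using expand[of x] by (simp add: sum.cartesian_product' UNIV_bool add.commute)
    qed simp
    then have "card ?K = DIM('v)" by (rule full_lattice_rank)
    then show ?thesis using full_lattice_rank[OF lattice] by (simp add: card_cartesian_product)
  qed
  then obtain h :: "'n \<Rightarrow> nat" where h: "bij_betw h UNIV {..<m}"
    using ex_bij_betw_finite_nat[of "UNIV :: 'n set"] by (auto simp: lessThan_atLeast0)
  have lt: "h i < m" for i using h by (auto simp: bij_betw_def)
  have inj: "h i = h j \<longleftrightarrow> i = j" for i j using h by (auto simp: bij_betw_def inj_eq)
  have expand': "x = (\<Sum>i\<in>UNIV. (c x (f (h i)) / of_int (d (h i))) *\<^sub>R e (h i) + (c (e (h i)) x / of_int (d (h i))) *\<^sub>R f (h i))" for x
    by (rule trans[OF expand[of x] sum.reindex_bij_betw[OF h, symmetric]])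
  have G_add: "x + y \<in> G" if "x \<in> G" "y \<in> G" for x y
    using diff[OF that(1) diff[OF zero that(2)]] by simp
  have G_sum: "sum g I \<in> G" if "\<And>i. i \<in> I \<Longrightarrow> g i \<in> G" for g and I :: "'n set"
    using that zero by (induction I rule: infinite_finite_induct) (auto intro: G_add)
  have G_int: "t *\<^sub>R x \<in> G" if "t \<in> \<int>" "x \<in> G" for t x
    using that int_multiple_mem[OF zero diff] by (auto elim: Ints_cases)
  show thesis
  proof (rule that[of "d \<circ> h" "e \<circ> h" "f \<circ> h"])
    show "x \<in> G \<longleftrightarrow> (\<forall>i. c x ((f \<circ> h) i) / of_int ((d \<circ> h) i) \<in> \<int> \<and> c ((e \<circ> h) i) x / of_int ((d \<circ> h) i) \<in> \<int>)" for x
    proof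
      assume "x \<in> G" then show "\<forall>i. c x ((f \<circ> h) i) / of_int ((d \<circ> h) i) \<in> \<int> \<and> c ((e \<circ> h) i) x / of_int ((d \<circ> h) i) \<in> \<int>"
        using ints lt by simp
    next
      assume "\<forall>i. c x ((f \<circ> h) i) / of_int ((d \<circ> h) i) \<in> \<int> \<and> c ((e \<circ> h) i) x / of_int ((d \<circ> h) i) \<in> \<int>"
      then show "x \<in> G"
        using mem lt by (subst expand'[of x]) (intro G_sum G_add G_int; simp)
    qed
    show "x = (\<Sum>i\<in>UNIV. (c x ((f \<circ> h) i) / of_int ((d \<circ> h) i)) *\<^sub>R (e \<circ> h) i + (c ((e \<circ> h) i) x / of_int ((d \<circ> h) i)) *\<^sub>R (f \<circ> h) i)" for x
      using expand'[of x] by simp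
  qed (use mem rel lt inj in auto)
qed

section \<open>Products of elliptic curves\<close>

text \<open>The space \<open>(\<real>\<^sup>2)\<^sup>n\<close> is treated as \<open>\<real>\<^sup>n \<otimes> \<real>\<^sup>2\<close>: \<open>slice 1\<close> and \<open>slice 2\<close> are its two
  projections to \<open>\<real>\<^sup>n\<close>, and \<open>lift\<close> are the corresponding embeddings.\<close>

definition slice :: "2 \<Rightarrow> (real ^ 2) ^ 'n \<Rightarrow> real ^ 'n" where
  "slice k u = (\<chi> i. u $ i $ k)"

lemma slice_nth [simp]: "slice k u $ i = u $ i $ k"
  by (simp add: slice_def)

lemma slice_add [simp]: "slice k (u + y) = slice k u + slice k y"
  and slice_scale [simp]: "slice k (t *\<^sub>R u) = t *\<^sub>R slice k u"
  by (simp_all add: vec_eq_iff)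

lemma slice_eqI:
  fixes u y :: "(real ^ 2) ^ 'n"
  assumes "slice 1 u = slice 1 y" "slice 2 u = slice 2 y"
  shows "u = y"
  using assms by (simp add: vec_eq_iff forall_2)

definition lift :: "2 \<Rightarrow> real ^ 'n \<Rightarrow> (real ^ 2) ^ 'n" where
  "lift k x = (\<chi> i. axis k (x $ i))"

lemma lift_add: "lift k (x + y) = lift k x + lift k y"
  and lift_scale: "lift k (t *\<^sub>R x) = t *\<^sub>R lift k x"
  and lift_zero: "lift k 0 = 0"
  by (simp_all add: lift_def vec_eq_iff axis_def)

lemma lift_slice: "y = lift 1 (slice 1 y) + lift 2 (slice 2 y)"
  by (simp add: lift_def vec_eq_iff forall_2 axis_def)

lemma lift_expand: "lift k x = (\<Sum>i\<in>UNIV. x $ i *\<^sub>R axis i (axis k 1))" for x :: "real ^ 'n::finite"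
proof -
  have "(\<Sum>i\<in>UNIV. x $ i *\<^sub>R axis i (axis k (1 :: real)) $ j $ l)
      = (\<Sum>i\<in>UNIV. if j = i then axis k (x $ i) $ l else 0)" for j l
    by (intro sum.cong) (auto simp: axis_def)
  then show ?thesis by (simp add: vec_eq_iff lift_def)
qed

text \<open>The form \<open>R \<otimes> det\<close> on \<open>\<real>\<^sup>n \<otimes> \<real>\<^sup>2\<close>, where \<open>det\<close> is the determinant of two vectors of the
  plane. It is alternating if \<open>R\<close> is symmetric.\<close>

definition det_form :: "(real ^ 'n \<Rightarrow> real ^ 'n \<Rightarrow> real) \<Rightarrow> ((real ^ 2) ^ 'n::finite) form" where
  "det_form R = form_of (\<lambda>u y. R (slice 1 u) (slice 2 y) - R (slice 2 u) (slice 1 y))"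

lemma det_form_apply:
  assumes "bilinear R"
  shows "det_form R u y = R (slice 1 u) (slice 2 y) - R (slice 2 u) (slice 1 y)"
proof -
  have "bilinear (\<lambda>u y. R (slice 1 u) (slice 2 y) - R (slice 2 u) (slice 1 y))"
    unfolding bilinear_def
    by (intro conjI allI linearI)
      (simp_all add: bilinear_ladd[OF assms] bilinear_radd[OF assms] bilinear_lmul[OF assms]
        bilinear_rmul[OF assms] right_diff_distrib)
  then show ?thesis unfolding det_form_def by (rule form_of_apply)
qed

text \<open>The matrix of \<open>I\<^sub>\<omega>\<close> for \<open>\<omega> = (a + ib) c\<close> in the basis \<open>e\<^sub>i, d\<^sub>i f\<^sub>i\<^sup>*\<close>. It has determinant one.\<close>

definition ell_cstr :: "real \<Rightarrow> real \<Rightarrow> ((real ^ 2) \<Rightarrow>\<^sub>L (real ^ 2))" where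
  "ell_cstr a b = Blinfun (\<lambda>x. vector [(a / b) * x $ 1 - (1 / b) * x $ 2,
     (b + a\<^sup>2 / b) * x $ 1 - (a / b) * x $ 2])"

lemma ell_cstr_apply:
  "ell_cstr a b x = vector [(a / b) * x $ 1 - (1 / b) * x $ 2,
     (b + a\<^sup>2 / b) * x $ 1 - (a / b) * x $ 2]"
proof -
  have "linear (\<lambda>x :: real ^ 2. vector [(a / b) * x $ 1 - (1 / b) * x $ 2,
     (b + a\<^sup>2 / b) * x $ 1 - (a / b) * x $ 2] :: real ^ 2)"
    by (intro linearI) (simp_all add: vec_eq_iff forall_2 algebra_simps
        add_divide_distrib)
  then show ?thesis
    unfolding ell_cstr_def by (simp add: bounded_linear_Blinfun_apply linear_conv_bounded_linear)
qed

definition ell_torus :: "real \<Rightarrow> real \<Rightarrow> int \<Rightarrow> (real ^ 2) torus" where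
  "ell_torus a b N =
     \<lparr>periods = {x. x $ 1 \<in> \<int> \<and> of_int N * x $ 2 \<in> \<int>}, cstr = ell_cstr a b\<rparr>"

lemma ell_torus_simps [simp]:
  "x \<in> periods (ell_torus a b N) \<longleftrightarrow> x $ 1 \<in> \<int> \<and> of_int N * x $ 2 \<in> \<int>"
  "cstr (ell_torus a b N) = ell_cstr a b"
  by (simp_all add: ell_torus_def)

lemma elliptic_curve_ell_torus:
  assumes "b \<noteq> 0" "N > 0"
  shows "elliptic_curve (ell_torus a b N)"
proof -
  let ?\<beta> = "\<lambda>k :: 2. axis k (if k = 1 then 1 else 1 / of_int N) :: real ^ 2"
  let ?\<tau> = "\<lambda>(k :: 2) (x :: real ^ 2). (if k = 1 then 1 else of_int N) * x $ k"
  have "full_lattice (card (UNIV :: 2 set)) {x. \<forall>k\<in>UNIV. ?\<tau> k x \<in> \<int>}"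
    by (rule full_latticeI[where \<beta> = ?\<beta>])
      (use assms in \<open>auto intro!: linearI simp: algebra_simps axis_def forall_2 sum_2 vec_eq_iff\<close>)
  also have "{x. \<forall>k\<in>UNIV. ?\<tau> k x \<in> \<int>} = periods (ell_torus a b N)"
    by (auto simp: forall_2)
  finally have "full_lattice (2 * 1) (periods (ell_torus a b N))" by simp
  moreover have "ell_cstr a b o\<^sub>L ell_cstr a b = - id_blinfun"
    using assms(1) by (intro blinfun_eqI)
      (simp add: ell_cstr_apply vec_eq_iff forall_2 blinfun.minus_left field_simps power2_eq_square)
  ultimately show ?thesis by (simp add: elliptic_curve_def complex_torus_def)
qed

text \<open>For the kernel of an isogeny below: \<open>h\<close> sends a point to its coset and \<open>g\<close> to its residues.\<close>

lemma finite_image_of_factor: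
  assumes "finite (g ` M)" "\<And>x y. x \<in> M \<Longrightarrow> y \<in> M \<Longrightarrow> g x = g y \<Longrightarrow> h x = h y"
  shows "finite (h ` M)"
proof -
  have "h x = h (inv_into M g (g x))" if "x \<in> M" for x
    using that by (intro assms(2)) (simp_all add: inv_into_into f_inv_into_f)
  then have "h ` M = (\<lambda>z. h (inv_into M g z)) ` g ` M"
    by (simp add: image_image cong: image_cong)
  then show ?thesis using assms(1) by simp
qed

text \<open>Multiplication by \<open>N\<close> maps \<open>\<int> \<oplus> N\<^sup>-\<^sup>1 \<int>\<close> into \<open>\<int> \<oplus> \<int>\<close>, hence into \<open>\<int> \<oplus> M\<^sup>-\<^sup>1 \<int>\<close>, and it
  commutes with every complex structure. The kernel is the quotient of \<open>N\<^sup>-\<^sup>1 \<int> \<oplus> (N M)\<^sup>-\<^sup>1 \<int>\<close> by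
  \<open>\<int> \<oplus> N\<^sup>-\<^sup>1 \<int>\<close>, and its elements are separated by residues modulo \<open>N\<close> and \<open>M\<close>.\<close>

lemma isogenous_ell_torus:
  assumes "N > 0" "M > 0"
  shows "isogenous (ell_torus a b N) (ell_torus a b M)"
proof -
  let ?E = "ell_torus a b N" and ?F = "ell_torus a b M"
  let ?f = "blinfun_scaleR_right (real_of_int N) :: (real ^ 2) \<Rightarrow>\<^sub>L (real ^ 2)"
  let ?K = "{x. ?f x \<in> periods ?F}"
  let ?r = "{(x, y). x - y \<in> periods ?E}"
  have f: "?f x = of_int N *\<^sub>R x" for x by (simp add: blinfun_scaleR_right.rep_eq)
  define g where "g x = (\<lfloor>of_int N * x $ 1\<rfloor> mod N, \<lfloor>of_int (N * M) * x $ 2\<rfloor> mod M)" for x :: "real ^ 2"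
  have K: "of_int N * x $ 1 \<in> \<int>" "of_int (N * M) * x $ 2 \<in> \<int>" if "x \<in> ?K" for x
    using that by (auto simp: f mult_ac)
  have "g ` ?K \<subseteq> {0..<N} \<times> {0..<M}" using assms by (auto simp: g_def)
  then have "finite (g ` ?K)" by (rule finite_subset) simp
  then have "finite ((\<lambda>x. ?r `` {x}) ` ?K)"
  proof (rule finite_image_of_factor)
    fix x y assume x: "x \<in> ?K" and y: "y \<in> ?K" and eq: "g x = g y"
    obtain k l k' l' where kl: "of_int N * x $ 1 = of_int k" "of_int (N * M) * x $ 2 = of_int l"
        "of_int N * y $ 1 = of_int k'" "of_int (N * M) * y $ 2 = of_int l'"
      using K[OF x] K[OF y] by (auto elim!: Ints_cases)
    have "k mod N = k' mod N" "l mod M = l' mod M"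
      using eq by (simp_all add: g_def kl del: of_int_mult)
    then obtain p q where pq: "k - k' = N * p" "l - l' = M * q"
      by (metis mod_eq_dvd_iff dvd_def)
    have "of_int N * (x - y) $ 1 = of_int N * (of_int p :: real)"
      using arg_cong[OF pq(1), of "of_int :: int \<Rightarrow> real"] kl by (simp add: algebra_simps)
    then have 1: "(x - y) $ 1 = of_int p" using assms by simp
    have "of_int M * (of_int N * (x - y) $ 2) = of_int M * (of_int q :: real)"
      using arg_cong[OF pq(2), of "of_int :: int \<Rightarrow> real"] kl by (simp add: algebra_simps)
    then have 2: "of_int N * (x - y) $ 2 = of_int q" using assms by simp
    have xy: "x - y \<in> periods ?E" unfolding ell_torus_simps 1 2 by simp
    show "?r `` {x} = ?r `` {y}"
    proof -
      have "x - z \<in> periods ?E \<longleftrightarrow> y - z \<in> periods ?E" for z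
      proof -
        have "x - z = (x - y) + (y - z)" "y - z = (x - z) - (x - y)" by simp_all
        then show ?thesis
          using xy unfolding ell_torus_simps
          by (metis Ints_add Ints_diff distrib_left right_diff_distrib vector_add_component vector_minus_component)
      qed
      then show ?thesis by auto
    qed
  qed
  moreover have "?K // ?r = (\<lambda>x. ?r `` {x}) ` ?K" unfolding quotient_def by blast
  ultimately have fin: "finite (?K // ?r)" by simp
  have hom: "torus_hom ?E ?F ?f"
    unfolding torus_hom_def
  proof
    show "?f o\<^sub>L cstr ?E = cstr ?F o\<^sub>L ?f"
      by (rule blinfun_eqI) (simp add: f blinfun.scaleR_right)
    show "?f ` periods ?E \<subseteq> periods ?F"
      using Ints_mult[OF Ints_of_int] by (auto simp: f mult_ac)
  qed
  have surj: "\<exists>x. ?f x - y \<in> periods ?F" for y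
    using assms by (intro exI[of _ "(1 / of_int N) *\<^sub>R y"]) (simp add: f)
  show ?thesis
    unfolding isogenous_def isogeny_def
    by (intro exI[of _ ?f] conjI allI hom surj fin)
qed

abbreviation ell_product :: "real \<Rightarrow> real \<Rightarrow> ('n::finite \<Rightarrow> int) \<Rightarrow> ((real ^ 2) ^ 'n) torus" where
  "ell_product a b d \<equiv> vec_torus (\<lambda>i. ell_torus a b (d i))"

lemma full_lattice_vec_ell:
  fixes d :: "'n::finite \<Rightarrow> int"
  assumes "\<And>i. d i > 0"
  shows "full_lattice (2 * CARD('n)) (periods (ell_product a b d))"
proof -
  let ?w = "\<lambda>i (k :: 2). if k = 1 then 1 else real_of_int (d i)"
  let ?\<beta> = "\<lambda>(i, k). axis i (axis k (1 / ?w i k)) :: (real ^ 2) ^ 'n"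
  let ?\<tau> = "\<lambda>(i, k) (x :: (real ^ 2) ^ 'n). ?w i k * x $ i $ k"
  have d: "d i \<noteq> 0" for i using assms[of i] by simp
  have "full_lattice (card (UNIV :: ('n \<times> 2) set)) {x. \<forall>k\<in>UNIV. ?\<tau> k x \<in> \<int>}"
  proof (rule full_latticeI[where \<beta> = ?\<beta>])
    show "linear (?\<tau> k)" for k by (cases k) (auto intro!: linearI simp: algebra_simps)
    show "?\<tau> k (?\<beta> l) = (if k = l then 1 else 0)" for k l
      using d by (cases k; cases l) (auto simp: axis_def)
    show "x = (\<Sum>k\<in>UNIV. ?\<tau> k x *\<^sub>R ?\<beta> k)" for x
    proof -
      have scale: "?\<tau> k x *\<^sub>R ?\<beta> k = axis (fst k) (axis (snd k) (x $ fst k $ snd k))" for k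
        using d by (cases k) (auto simp: axis_def vec_eq_iff)
      have "(\<Sum>k\<in>UNIV. ?\<tau> k x *\<^sub>R ?\<beta> k) = (\<Sum>i\<in>UNIV. \<Sum>k\<in>UNIV. axis i (axis k (x $ i $ k)))"
        unfolding scale UNIV_Times_UNIV[symmetric] by (simp add: sum.cartesian_product split_beta)
      also have "\<dots> = x"
      proof -
        have "(\<Sum>i\<in>UNIV. \<Sum>k\<in>UNIV. axis i (axis k (x $ i $ k)) $ j $ l) = x $ j $ l" for j l
        proof -
          have "(\<Sum>i\<in>UNIV. \<Sum>k\<in>UNIV. axis i (axis k (x $ i $ k)) $ j $ l)
             = (\<Sum>i\<in>UNIV. if j = i then (\<Sum>k\<in>UNIV. if l = k then x $ i $ k else 0) else 0)"
            by (intro sum.cong) (auto simp: axis_def intro!: sum.cong)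
          then show ?thesis by simp
        qed
        then show ?thesis by (simp add: vec_eq_iff)
      qed
      finally show ?thesis by simp
    qed
  qed simp
  also have "{x. \<forall>k\<in>UNIV. ?\<tau> k x \<in> \<int>} = periods (ell_product a b d)"
    by (auto simp: vec_torus_def forall_2)
  finally have "full_lattice (CARD('n) * 2) (periods (ell_product a b d))" by simp
  then show ?thesis by (simp only: mult.commute)
qed

lemma slice_vec_cstr:
  fixes d :: "'n::finite \<Rightarrow> int" and a b :: real
  defines "J \<equiv> cstr (ell_product a b d)"
  shows "slice 1 (J u) = (a / b) *\<^sub>R slice 1 u - (1 / b) *\<^sub>R slice 2 u"
    and "slice 2 (J u) = (b + a\<^sup>2 / b) *\<^sub>R slice 1 u - (a / b) *\<^sub>R slice 2 u"
  by (simp_all add: J_def vec_torus_def vec_cstr.rep_eq ell_cstr_apply vec_eq_iff)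

lemma complex_torus_vec_ell:
  fixes d :: "'n::finite \<Rightarrow> int"
  assumes "b \<noteq> 0" "\<And>i. d i > 0"
  shows "complex_torus CARD('n) (ell_product a b d)"
  unfolding complex_torus_def
proof
  show "full_lattice (2 * CARD('n)) (periods (ell_product a b d))"
    using assms(2) by (rule full_lattice_vec_ell)
  show "cstr (ell_product a b d) o\<^sub>L cstr (ell_product a b d)
      = - id_blinfun"
    using assms(1) by (intro blinfun_eqI slice_eqI)
      (simp_all add: slice_vec_cstr blinfun.minus_left vec_eq_iff field_simps power2_eq_square)
qed

text \<open>The determinant is invariant because the complex structure acts on the factor \<open>\<real>\<^sup>2\<close> alone,
  with determinant one.\<close>

lemma det_form_invariant:
  fixes d :: "'n::finite \<Rightarrow> int"
    and a b :: real
  assumes R: "bilinear R" "\<And>x y. R x y = R y x" and b: "b \<noteq> 0"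
  defines "J \<equiv> cstr (ell_product a b d)"
  shows "det_form R (J u) (J y) = det_form R u y"
proof -
  define r s t where "r = 1 / b" and "s = b + a\<^sup>2 / b" and "t = a / b"
  note R_simps = bilinear_lsub[OF R(1)] bilinear_rsub[OF R(1)] bilinear_lmul[OF R(1)]
    bilinear_rmul[OF R(1)]
  have det: "r * s - t * t = 1"
    using b by (simp add: r_def s_def t_def field_simps power2_eq_square)
  have "det_form R (J u) (J y)
      = (r * s - t * t) * (R (slice 1 u) (slice 2 y) - R (slice 2 u) (slice 1 y))"
    unfolding det_form_apply[OF R(1)] J_def slice_vec_cstr r_def[symmetric] s_def[symmetric]
      t_def[symmetric]
    by (simp add: R_simps algebra_simps)
  then show ?thesis by (simp add: det det_form_apply[OF R(1)])
qed

text \<open>Completing the square: up to the factor \<open>b\<close>, the Hermitian form of \<open>R \<otimes> det\<close> is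
  \<open>R\<close> applied to \<open>u\<^sub>2 - a u\<^sub>1\<close> plus \<open>b\<^sup>2\<close> times \<open>R\<close> applied to \<open>u\<^sub>1\<close>, hence definite with \<open>R\<close>.\<close>

lemma det_form_cstr:
  fixes d :: "'n::finite \<Rightarrow> int"
    and a b :: real
  assumes R: "bilinear R" "\<And>x y. R x y = R y x" and b: "b \<noteq> 0"
  defines "J \<equiv> cstr (ell_product a b d)"
  shows "det_form R u (J u) =
    (R (slice 2 u - a *\<^sub>R slice 1 u) (slice 2 u - a *\<^sub>R slice 1 u) + b\<^sup>2 * R (slice 1 u) (slice 1 u)) / b"
  unfolding det_form_apply[OF R(1)] J_def slice_vec_cstr using b R(2)[of "slice 2 u" "slice 1 u"]
  by (simp add: bilinear_lsub[OF R(1)] bilinear_rsub[OF R(1)] bilinear_lmul[OF R(1)]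
      bilinear_rmul[OF R(1)] field_simps power2_eq_square)

lemma bilinear_expand_vec:
  fixes R :: "real ^ 'n::finite \<Rightarrow> real ^ 'n \<Rightarrow> real"
  assumes "bilinear R"
  shows "R x y = (\<Sum>i\<in>UNIV. \<Sum>j\<in>UNIV. R (axis i 1) (axis j 1) * (x $ i * y $ j))"
proof -
  have expand: "x = (\<Sum>i\<in>UNIV. x $ i *\<^sub>R axis i 1)" for x :: "real ^ 'n"
    using basis_expansion[of x] by (simp add: scalar_mult_eq_scaleR)
  have "R x y = R (\<Sum>i\<in>UNIV. x $ i *\<^sub>R axis i 1) (\<Sum>j\<in>UNIV. y $ j *\<^sub>R axis j 1)"
    by (simp add: expand[symmetric])
  also have "\<dots> = (\<Sum>(i, j)\<in>UNIV \<times> UNIV. R (x $ i *\<^sub>R axis i 1) (y $ j *\<^sub>R axis j 1))"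
    by (rule bilinear_sum[OF assms])
  finally show ?thesis
    by (simp add: bilinear_lmul[OF assms] bilinear_rmul[OF assms] sum.cartesian_product mult_ac)
qed

text \<open>The second coordinate of a period of the factor \<open>i\<close> lies in \<open>d\<^sub>i\<^sup>-\<^sup>1 \<int>\<close>. Hence the forms
  \<open>B i j \<otimes> det\<close> below, which are scaled by the product \<open>N\<close> of all \<open>d\<^sub>i\<close>, are integral, and the
  \<open>B i j\<close> span the space of symmetric forms.\<close>

lemma det_form_in_NS_real:
  fixes d :: "'n::finite \<Rightarrow> int"
  assumes R: "bilinear R" "\<And>x y. R x y = R y x" and b: "b \<noteq> 0" and d: "\<And>i. d i > 0"
  shows "det_form R \<in> NS_real (ell_product a b d)" (is "_ \<in> NS_real ?E")
proof -
  define N where "N = (\<Prod>i\<in>UNIV. d i)"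
  have N: "N > 0" unfolding N_def by (intro prod_pos) (simp add: d)
  have dvd: "d i dvd N" for i unfolding N_def by (rule dvd_prodI) auto
  define B where "B i j x y = of_int N * (x $ i * y $ j + x $ j * y $ i)" for i j :: 'n and x y :: "real ^ 'n"
  have B: "bilinear (B i j)" "B i j x y = B i j y x" for i j x y
    unfolding bilinear_def B_def by (auto intro!: linearI simp: algebra_simps)
  have N_Ints: "of_int N * t \<in> \<int>" if "of_int (d i) * t \<in> \<int>" for t :: real and i
  proof -
    obtain k where "N = d i * k" using dvd[of i] by (auto elim: dvdE)
    then have "of_int N * t = of_int k * (of_int (d i) * t)" by simp
    then show ?thesis using that by (metis Ints_mult Ints_of_int)
  qed
  have "det_form (B i j) \<in> NS ?E" for i j
  proof (rule NS_I)
    show "det_form (B i j) x y = - det_form (B i j) y x" for x y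
      unfolding det_form_apply[OF B(1)] by (simp add: B(2)[of i j "slice 1 y"] B(2)[of i j "slice 2 y"])
    show "det_form (B i j) (cstr ?E x) (cstr ?E y) = det_form (B i j) x y" for x y
      by (rule det_form_invariant[OF B b])
    fix x y assume x: "x \<in> periods ?E" and y: "y \<in> periods ?E"
    have int: "z $ l $ 1 \<in> \<int>" "of_int N * z $ l $ 2 \<in> \<int>" if "z \<in> periods ?E" for z l
      using that N_Ints by (auto simp: vec_torus_def)
    have mixed: "B i j (slice 1 z) (slice 2 z') \<in> \<int>" if "z \<in> periods ?E" "z' \<in> periods ?E" for z z'
    proof -
      have "B i j (slice 1 z) (slice 2 z') = z $ i $ 1 * (of_int N * z' $ j $ 2) + z $ j $ 1 * (of_int N * z' $ i $ 2)"
        by (simp add: B_def algebra_simps)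
      then show ?thesis using int[OF that(1)] int[OF that(2)] by simp
    qed
    show "det_form (B i j) x y \<in> \<int>"
      unfolding det_form_apply[OF B(1)] B(2)[of i j "slice 2 x"]
      by (intro Ints_diff mixed x y)
  qed
  then have mem: "(\<Sum>i\<in>UNIV. \<Sum>j\<in>UNIV. (R (axis i 1) (axis j 1) / (2 * of_int N)) *\<^sub>R det_form (B i j)) \<in> NS_real ?E"
    unfolding NS_real_def by (intro span_sum span_scale span_base)
  have R_eq: "R x y = (\<Sum>i\<in>UNIV. \<Sum>j\<in>UNIV. R (axis i 1) (axis j 1) / (2 * of_int N) * B i j x y)" for x y
  proof -
    have "2 * R x y = R x y + R y x" by (simp add: R(2)[of y x])
    also have "\<dots> = (\<Sum>i\<in>UNIV. \<Sum>j\<in>UNIV. R (axis i 1) (axis j 1) * (x $ i * y $ j + x $ j * y $ i))"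
      unfolding bilinear_expand_vec[OF R(1), of x y] bilinear_expand_vec[OF R(1), of y x] sum.distrib[symmetric]
      by (simp add: algebra_simps)
    finally have "R x y = (\<Sum>i\<in>UNIV. \<Sum>j\<in>UNIV. R (axis i 1) (axis j 1) * (x $ i * y $ j + x $ j * y $ i)) / 2"
      by simp
    also have "\<dots> = (\<Sum>i\<in>UNIV. \<Sum>j\<in>UNIV. R (axis i 1) (axis j 1) / (2 * of_int N) * B i j x y)"
      unfolding sum_divide_distrib using N by (intro sum.cong refl) (simp add: B_def)
    finally show ?thesis .
  qed
  have "det_form R = (\<Sum>i\<in>UNIV. \<Sum>j\<in>UNIV. (R (axis i 1) (axis j 1) / (2 * of_int N)) *\<^sub>R det_form (B i j))"
  proof (intro blinfun_eqI)
    fix u y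
    show "det_form R u y = (\<Sum>i\<in>UNIV. \<Sum>j\<in>UNIV. (R (axis i 1) (axis j 1) / (2 * of_int N)) *\<^sub>R det_form (B i j)) u y"
      unfolding det_form_apply[OF R(1)] blinfun.sum_left blinfun.scaleR_left det_form_apply[OF B(1)]
        R_eq[of "slice 1 u"] R_eq[of "slice 2 u"] sum_subtractf[symmetric]
      by (simp add: right_diff_distrib)
  qed
  then show ?thesis using mem by simp
qed

section \<open>The mirror map of a polarized torus\<close>

text \<open>The first component \<open>x\<close> of \<open>I\<^sub>\<omega>(v, w)\<close> is \<open>\<phi>\<^sub>2\<^sup>-\<^sup>1 (\<phi>\<^sub>1 v - w)\<close>, and its second one is
  \<open>\<phi>\<^sub>2 v + \<phi>\<^sub>1 x\<close>. This form needs no inverse and is the one checked later for \<open>A\<close> and for \<open>E\<close>.\<close>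

lemma I_cstr_eq:
  fixes \<omega> :: "'v::real_normed_vector form \<times> 'v form"
  assumes bij: "bij (blinfun_apply (snd \<omega>))" and x: "snd \<omega> x = fst \<omega> v - w"
  shows "I_cstr \<omega> (v, w) = (x, snd \<omega> v + fst \<omega> x)"
proof -
  obtain s t where s: "snd \<omega> s = fst \<omega> v" and t: "snd \<omega> t = w"
    using bij by (metis bij_pointE)
  have inj: "inj (blinfun_apply (snd \<omega>))" using bij by (rule bij_is_inj)
  have inv: "the_inv (blinfun_apply (snd \<omega>)) (snd \<omega> y) = y" for y
    using inj by (simp add: the_inv_f_f)
  have "snd \<omega> (s - t) = snd \<omega> x" by (simp add: blinfun.diff_right s t x)
  then have st: "x = s - t" using inj by (simp add: inj_eq)
  show ?thesis
    using inv[of s] inv[of t]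
    by (simp add: I_cstr_def Let_def s t st blinfun.diff_right add_diff_eq)
qed

locale symplectic_polarization =
  fixes A :: "'v::euclidean_space torus" and c :: "'v form"
    and e f :: "'n::finite \<Rightarrow> 'v" and d :: "'n \<Rightarrow> int"
  assumes torus: "complex_torus CARD('n) A" and ample: "ample A c"
    and d_pos: "\<And>i. d i > 0"
    and ee: "\<And>i j. c (e i) (e j) = 0" and ff: "\<And>i j. c (f i) (f j) = 0"
    and ef: "\<And>i j. c (e i) (f j) = (if i = j then of_int (d i) else 0)"
    and expand: "\<And>x. x = (\<Sum>i\<in>UNIV. (c x (f i) / of_int (d i)) *\<^sub>R e i + (c (e i) x / of_int (d i)) *\<^sub>R f i)"
    and periods_iff: "\<And>x. x \<in> periods A \<longleftrightarrow> (\<forall>i. c x (f i) / of_int (d i) \<in> \<int> \<and> c (e i) x / of_int (d i) \<in> \<int>)"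
begin

abbreviation J :: "'v \<Rightarrow> 'v" where "J \<equiv> blinfun_apply (cstr A)"

lemma c_NS: "c \<in> NS A" using ample by (simp add: ample_def)

lemma skew: "c x y = - c y x" by (rule NS_skew[OF c_NS])

lemma self [simp]: "c x x = 0" using skew[of x x] by simp

lemma c_J: "c (J x) (J y) = c x y" by (rule NS_invariant[OF c_NS])

lemma J_J [simp]: "J (J x) = - x"
proof -
  have "(cstr A o\<^sub>L cstr A) x = (- id_blinfun) x"
    using torus by (simp add: complex_torus_def)
  then show ?thesis by (simp add: blinfun.minus_left)
qed

lemma c_pos: "v \<noteq> 0 \<Longrightarrow> c v (J v) > 0"
  using ample by (simp add: ample_def)

lemma d_nonzero [simp]: "d i \<noteq> 0" using d_pos[of i] by simp

lemma nondeg: "(\<And>y. c x y = 0) \<Longrightarrow> x = 0"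
  using c_pos[of x] by fastforce

lemma bij_c: "bij (blinfun_apply c)"
  using nondeg by (rule nondegenerate_form_bij)

text \<open>The coordinates of \<open>v\<close> along the \<open>e\<^sub>i\<close>, that is, the projection of \<open>V\<close> along the Lagrangian
  subspace spanned by the \<open>f\<^sub>i\<close>; \<open>emb\<close> below splits it.\<close>

definition p :: "'v \<Rightarrow> real ^ 'n" where "p v = (\<chi> i. c v (f i) / of_int (d i))"

definition emb :: "real ^ 'n \<Rightarrow> 'v" where "emb x = (\<Sum>i\<in>UNIV. x $ i *\<^sub>R e i)"

lemma p_add: "p (x + y) = p x + p y" and p_diff: "p (x - y) = p x - p y"
  and p_scale: "p (t *\<^sub>R x) = t *\<^sub>R p x" and p_minus: "p (- x) = - p x" and p_zero: "p 0 = 0"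
  by (simp_all add: p_def vec_eq_iff blinfun.bilinear_simps add_divide_distrib diff_divide_distrib)

lemma emb_add: "emb (x + y) = emb x + emb y" and emb_diff: "emb (x - y) = emb x - emb y"
  and emb_scale: "emb (t *\<^sub>R x) = t *\<^sub>R emb x"
  by (simp_all add: emb_def scaleR_add_left scaleR_diff_left sum.distrib sum_subtractf scaleR_sum_right)

lemma c_emb_f: "c (emb x) (f i) = x $ i * of_int (d i)"
  by (simp add: emb_def blinfun.sum_left blinfun.bilinear_simps ef if_distrib cong: if_cong)

lemma p_emb [simp]: "p (emb x) = x"
  by (simp add: p_def c_emb_f vec_eq_iff)

lemma decompose: "v = emb (p v) + (\<Sum>i\<in>UNIV. (c (e i) v / of_int (d i)) *\<^sub>R f i)"
  using expand[of v] by (simp add: emb_def p_def sum.distrib)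

lemma c_emb_emb [simp]: "c (emb x) (emb y) = 0"
  by (simp add: emb_def blinfun.sum_left blinfun.sum_right blinfun.bilinear_simps ee)

lemma c_e_emb: "c (e i) (emb x) = 0"
  by (simp add: emb_def blinfun.sum_right blinfun.bilinear_simps ee)

lemma c_kernel: "c v w = 0" if "p v = 0" "p w = 0"
proof -
  have emb0: "emb 0 = 0" by (simp add: emb_def)
  show ?thesis
    by (subst decompose[of v], subst decompose[of w])
      (simp add: that emb0 blinfun.sum_left blinfun.sum_right blinfun.bilinear_simps ff)
qed

text \<open>The kernel of \<open>p\<close> is isotropic, so it meets its image under \<open>J\<close> only in zero: otherwise
  \<open>c(v, Jv)\<close> would vanish for some \<open>v \<noteq> 0\<close>. Therefore a vector is determined by \<open>p v\<close> and
  \<open>p (J v)\<close>, and by dimension both can be prescribed.\<close>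

lemma p_pJ_zero: "v = 0" if "p v = 0" "p (J v) = 0"
  using c_pos[of v] c_kernel[OF that] by fastforce

lemma ex_g: "\<exists>v. p v = 0 \<and> p (J v) = x"
proof -
  define F where "F v = (p v, p (J v))" for v
  have lin: "linear F"
    by (rule linearI) (simp_all add: F_def p_add p_scale blinfun.bilinear_simps)
  moreover have "inj F"
    unfolding linear_injective_0[OF lin] by (auto simp: F_def zero_prod_def intro: p_pJ_zero)
  moreover have "DIM('v) = DIM((real ^ 'n) \<times> (real ^ 'n))"
    using torus full_lattice_rank[of "2 * CARD('n)" "periods A"] by (simp add: complex_torus_def)
  ultimately have "surj F"
    by (intro linear_injective_imp_surjective) simp_all
  then obtain v where "F v = (0, x)" by (metis surj_def)
  then show ?thesis by (auto simp: F_def)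
qed

text \<open>The inverse of the isomorphism \<open>v \<mapsto> p (J v)\<close> from the kernel of \<open>p\<close> onto \<open>\<real>\<^sup>n\<close>.\<close>

definition g :: "real ^ 'n \<Rightarrow> 'v" where "g x = (SOME v. p v = 0 \<and> p (J v) = x)"

lemma p_g [simp]: "p (g x) = 0" and p_J_g [simp]: "p (J (g x)) = x"
  using someI_ex[OF ex_g[of x]] by (simp_all add: g_def)

lemma pair_eqI: "v = w" if "p v = p w" "p (J v) = p (J w)"
  using p_pJ_zero[of "v - w"] that by (simp add: p_diff blinfun.diff_right)

lemma g_add: "g (x + y) = g x + g y" and g_scale: "g (t *\<^sub>R x) = t *\<^sub>R g x"
  by (rule pair_eqI; simp add: p_add p_scale blinfun.bilinear_simps)+

lemma g_decompose: "v = J (g (p v)) + g (p (J v))"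
  by (rule pair_eqI) (simp_all add: p_add p_diff p_minus blinfun.bilinear_simps)

text \<open>These are the real and the imaginary part of the period matrix of \<open>A\<close>: with \<open>\<tau> = T + i R\<close>, the
  equation \<open>e\<^sub>i = - \<Sum>\<^sub>j \<tau>\<^sub>i\<^sub>j d\<^sub>j\<^sup>-\<^sup>1 f\<^sub>j\<close> holds in the complex vector space \<open>(V, J)\<close>. The mirror
  class is \<open>\<tau> \<otimes> det\<close>. Symmetry of \<open>T\<close> and \<open>R\<close> and positivity of \<open>R\<close>, shown below, are Riemann's
  bilinear relations.\<close>

definition R :: "real ^ 'n \<Rightarrow> real ^ 'n \<Rightarrow> real" where "R x y = c (g x) (J (g y))"

definition T :: "real ^ 'n \<Rightarrow> real ^ 'n \<Rightarrow> real" where "T x y = c (emb x) (J (g y))"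

lemma bilinear_R: "bilinear R" and bilinear_T: "bilinear T"
  unfolding bilinear_def R_def T_def
  by (auto intro!: linearI simp: g_add g_scale emb_add emb_scale blinfun.bilinear_simps)

lemma R_sym: "R x y = R y x"
proof -
  have "c (g x) (J (g y)) = c (J (g x)) (J (J (g y)))" by (simp only: c_J)
  also have "\<dots> = c (g y) (J (g x))"
    using skew[of "J (g x)" "g y"] by (simp add: blinfun.minus_right)
  finally show ?thesis by (simp add: R_def)
qed

lemma R_pos:
  assumes "x \<noteq> 0" shows "R x x > 0"
proof -
  have "g x \<noteq> 0" using assms p_J_g[of x] by (metis blinfun.zero_right p_zero)
  then show ?thesis unfolding R_def by (rule c_pos)
qed

lemma R_eq: "R x y = - c (emb x) (g y)"
proof -
  have "c (J (g x) - emb x) (g y) = 0" by (rule c_kernel) (simp_all add: p_diff)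
  then have "c (emb x) (g y) = c (J (g x)) (g y)" by (simp add: blinfun.bilinear_simps)
  also have "\<dots> = - R y x" unfolding R_def by (rule skew)
  finally show ?thesis using R_sym[of x y] by simp
qed

text \<open>Both \<open>g x\<close> and \<open>k x\<close> lie in the isotropic kernel of \<open>p\<close>; as \<open>J\<close> preserves \<open>c\<close>, the space of
  all \<open>J (g x) = emb x + k x\<close> is isotropic too. So it is the graph of a symmetric map.\<close>

lemma T_sym: "T x y = T y x"
proof -
  define k where "k x = J (g x) - emb x" for x
  have Jg: "J (g x) = emb x + k x" for x by (simp add: k_def)
  have kk: "c (k x) (k y) = 0" by (rule c_kernel) (simp_all add: k_def p_diff)
  have "0 = c (J (g x)) (J (g y))" by (simp add: c_J c_kernel)
  also have "\<dots> = c (emb x) (k y) + c (k x) (emb y)"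
    unfolding Jg by (simp add: blinfun.bilinear_simps kk)
  finally have "c (emb x) (k y) = c (emb y) (k x)" using skew[of "k x" "emb y"] by simp
  then show ?thesis unfolding T_def Jg by (simp add: blinfun.bilinear_simps)
qed

text \<open>The whole mirror statement for \<open>J\<close> rests on this identity, obtained by pairing the
  decomposition of \<open>v\<close> into \<open>J (g (p v))\<close> and \<open>g (p (J v))\<close> with the \<open>e\<^sub>i\<close>.\<close>

lemma T_minus_R: "T (p v) y - R (p (J v)) y = c (emb y) v"
proof -
  have "c (emb y) v = c (emb y) (J (g (p v))) + c (emb y) (g (p (J v)))"
    by (subst g_decompose[of v]) (rule blinfun.add_right)
  then show ?thesis
    using T_sym[of "p v" y] R_sym[of "p (J v)" y] R_eq[of y "p (J v)"] by (simp add: T_def)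
qed

text \<open>The first component of \<open>\<alpha> (v, w)\<close> is the part of \<open>(v, w)\<close> along the \<open>e\<^sub>i\<close> and \<open>d\<^sub>i f\<^sub>i\<^sup>*\<close>. The
  second one is the functional that \<open>Q\<close> associates with the part along the \<open>f\<^sub>i\<close> and \<open>e\<^sub>i\<^sup>*\<close>. For
  \<open>w = c z\<close> the first component is the pair \<open>(p v, p z)\<close>, as recorded in \<open>slice_fst_\<alpha>_c\<close> below.\<close>

definition \<alpha> :: "'v \<times> ('v \<Rightarrow>\<^sub>L real) \<Rightarrow> ((real ^ 2) ^ 'n) \<times> (((real ^ 2) ^ 'n) \<Rightarrow>\<^sub>L real)" where
  "\<alpha> = (\<lambda>(v, w). (\<chi> i. vector [p v $ i, w (f i) / of_int (d i)],
      Blinfun (\<lambda>y. w (emb (slice 1 y)) + c (emb (slice 2 y)) v)))"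

lemma slice_fst_\<alpha> [simp]:
  "slice 1 (fst (\<alpha> (v, w))) = p v"
  "slice 2 (fst (\<alpha> (v, w))) = (\<chi> i. w (f i) / of_int (d i))"
  by (simp_all add: \<alpha>_def vec_eq_iff)

lemma snd_\<alpha> [simp]: "snd (\<alpha> (v, w)) y = w (emb (slice 1 y)) + c (emb (slice 2 y)) v"
proof -
  have "bounded_linear (\<lambda>y :: (real ^ 2) ^ 'n. w (emb (slice 1 y)) + c (emb (slice 2 y)) v)"
    unfolding linear_conv_bounded_linear[symmetric]
    by (rule linearI) (simp_all add: emb_add emb_scale blinfun.bilinear_simps algebra_simps)
  then show ?thesis by (simp add: \<alpha>_def bounded_linear_Blinfun_apply)
qed

lemma slice_fst_\<alpha>_c: "slice 2 (fst (\<alpha> (v, c z))) = p z"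
  by (simp add: p_def)

lemma eq_\<alpha>I:
  fixes u' :: "((real ^ 2) ^ 'n) \<Rightarrow>\<^sub>L real" and w :: "'v \<Rightarrow>\<^sub>L real"
  assumes "slice 1 u = p v" "slice 2 u = (\<chi> i. w (f i) / of_int (d i))"
    and "\<And>y. u' y = w (emb (slice 1 y)) + c (emb (slice 2 y)) v"
  shows "\<alpha> (v, w) = (u, u')"
  by (rule prod_eqI) (auto intro!: slice_eqI blinfun_eqI simp: assms)

lemma linear_\<alpha>: "linear \<alpha>"
proof (rule linearI)
  fix x y :: "'v \<times> ('v \<Rightarrow>\<^sub>L real)" and t
  obtain v w v' w' where xy: "x = (v, w)" "y = (v', w')" by (cases x, cases y) blast
  have "\<alpha> (v + v', w + w') = (fst (\<alpha> (v, w)) + fst (\<alpha> (v', w')), snd (\<alpha> (v, w)) + snd (\<alpha> (v', w')))"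
    by (rule eq_\<alpha>I) (simp_all add: p_add blinfun.bilinear_simps add_divide_distrib vec_eq_iff)
  then show "\<alpha> (x + y) = \<alpha> x + \<alpha> y" by (simp add: xy plus_prod_def)
  have "\<alpha> (t *\<^sub>R v, t *\<^sub>R w) = (t *\<^sub>R fst (\<alpha> (v, w)), t *\<^sub>R snd (\<alpha> (v, w)))"
    by (rule eq_\<alpha>I) (simp_all add: p_scale blinfun.bilinear_simps vec_eq_iff algebra_simps)
  then show "\<alpha> (t *\<^sub>R x) = t *\<^sub>R \<alpha> x" by (simp add: xy scaleR_prod_def)
qed

lemma functional_expand:
  "w v = w (emb (p v)) + (\<Sum>i\<in>UNIV. (c (e i) v / of_int (d i)) * w (f i))"
  for w :: "'v \<Rightarrow>\<^sub>L real"
  by (subst decompose[of v]) (simp add: blinfun.add_right blinfun.sum_right blinfun.scaleR_right)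

text \<open>For \<open>x = (v, w)\<close> and \<open>y = (v', w')\<close> the functional \<open>snd (\<alpha> x)\<close> contributes the part of \<open>w v'\<close>
  along the \<open>e\<^sub>i\<close> and the part of \<open>w' v\<close> along the \<open>f\<^sub>i\<close>, and \<open>snd (\<alpha> y)\<close> contributes the others.\<close>

lemma Q_\<alpha>: "Q_form (\<alpha> x) (\<alpha> y) = Q_form x y"
proof -
  obtain v w v' w' where xy: "x = (v, w)" "y = (v', w')" by (cases x, cases y) blast
  have pair: "c (emb (\<chi> i. w (f i) / of_int (d i))) v = (\<Sum>i\<in>UNIV. (c (e i) v / of_int (d i)) * w (f i))"
    for w :: "'v \<Rightarrow>\<^sub>L real" and v
    by (simp add: emb_def blinfun.sum_left blinfun.sum_right blinfun.bilinear_simps mult_ac)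
  show ?thesis
    unfolding xy Q_form_def snd_\<alpha> slice_fst_\<alpha> pair fst_conv snd_conv
    using functional_expand[of w v'] functional_expand[of w' v] by simp
qed

text \<open>Injectivity follows from preservation of the nondegenerate form \<open>Q\<close>; a preimage is written down
  by reading the definition of \<open>\<alpha>\<close> backwards.\<close>

lemma bij_\<alpha>: "bij \<alpha>"
proof (rule bijI)
  have "x = 0" if "\<alpha> x = 0" for x
  proof -
    obtain v w where x: "x = (v, w)" by (cases x)
    have Q: "Q_form x y = 0" for y
      using Q_\<alpha>[of x y] that by (simp add: Q_form_def)
    have "w = 0" using Q[of "(_, 0)"] by (intro blinfun_eqI) (simp add: Q_form_def x)
    moreover have "v = 0" using Q[of "(0, c _)"] skew[of v] by (intro nondeg) (simp add: Q_form_def x)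
    ultimately show ?thesis by (simp add: x zero_prod_def)
  qed
  then show "inj \<alpha>" by (simp add: linear_injective_0[OF linear_\<alpha>])
  show "surj \<alpha>"
    unfolding surj_def
  proof
    fix z :: "((real ^ 2) ^ 'n) \<times> (((real ^ 2) ^ 'n) \<Rightarrow>\<^sub>L real)"
    obtain u u' where z: "z = (u, u')" by (cases z)
    define v where "v = emb (slice 1 u) + (\<Sum>i\<in>UNIV. (u' (axis i (axis 2 1)) / of_int (d i)) *\<^sub>R f i)"
    define h where "h v = u' (lift 1 (p v)) + (\<Sum>i\<in>UNIV. c (e i) v * (u $ i $ 2))" for v
    have "linear h"
      by (rule linearI) (simp_all add: h_def p_add p_scale lift_add lift_scale blinfun.bilinear_simps
          sum.distrib sum_distrib_left algebra_simps)
    then have w: "Blinfun h x = h x" for x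
      by (simp add: bounded_linear_Blinfun_apply linear_conv_bounded_linear)
    have "\<alpha> (v, Blinfun h) = (u, u')"
    proof (rule eq_\<alpha>I)
      have "p v = slice 1 u + p (\<Sum>i\<in>UNIV. (u' (axis i (axis 2 1)) / of_int (d i)) *\<^sub>R f i)"
        by (simp add: v_def p_add)
      also have "p (\<Sum>i\<in>UNIV. (u' (axis i (axis 2 1)) / of_int (d i)) *\<^sub>R f i) = 0"
        by (simp add: p_def vec_eq_iff blinfun.sum_left blinfun.sum_right blinfun.bilinear_simps ff)
      finally show "slice 1 u = p v" by simp
      have "h (f i) = u $ i $ 2 * of_int (d i)" for i
      proof -
        have "p (f i) = 0" by (simp add: p_def vec_eq_iff ff)
        then show ?thesis
          by (simp add: h_def ef lift_zero if_distrib if_distribR mult.commute cong: if_cong)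
      qed
      then show "slice 2 u = (\<chi> i. Blinfun h (f i) / of_int (d i))"
        by (simp add: w vec_eq_iff)
      fix y :: "(real ^ 2) ^ 'n"
      have "h (emb (slice 1 y)) = u' (lift 1 (slice 1 y))"
        by (simp add: h_def c_e_emb)
      moreover have "c (emb (slice 2 y)) v = u' (lift 2 (slice 2 y))"
        by (simp add: v_def blinfun.bilinear_simps blinfun.sum_right c_emb_f lift_expand mult.commute)
      moreover have "y = lift 1 (slice 1 y) + lift 2 (slice 2 y)"
        by (rule lift_slice)
      ultimately show "u' y = Blinfun h (emb (slice 1 y)) + c (emb (slice 2 y)) v"
        by (metis w blinfun.add_right)
    qed
    then show "\<exists>x. z = \<alpha> x" unfolding z by metis
  qed
qed

lemma integral_functional_iff:
  fixes w :: "'v \<Rightarrow>\<^sub>L real"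
  shows "(\<forall>x\<in>periods A. w x \<in> \<int>) \<longleftrightarrow> (\<forall>i. w (e i) \<in> \<int> \<and> w (f i) \<in> \<int>)"
proof
  assume w: "\<forall>x\<in>periods A. w x \<in> \<int>"
  have "e i \<in> periods A" "f i \<in> periods A" for i
    unfolding periods_iff by (auto simp: ee ff ef)
  then show "\<forall>i. w (e i) \<in> \<int> \<and> w (f i) \<in> \<int>" using w by blast
next
  assume w: "\<forall>i. w (e i) \<in> \<int> \<and> w (f i) \<in> \<int>"
  show "\<forall>x\<in>periods A. w x \<in> \<int>"
  proof
    fix x assume "x \<in> periods A"
    then have x: "\<forall>i. c x (f i) / of_int (d i) \<in> \<int> \<and> c (e i) x / of_int (d i) \<in> \<int>"
      by (simp add: periods_iff)
    have "w x = (\<Sum>i\<in>UNIV. (c x (f i) / of_int (d i)) * w (e i) + (c (e i) x / of_int (d i)) * w (f i))"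
      by (subst expand[of x]) (simp add: blinfun.sum_right blinfun.bilinear_simps)
    also have "\<dots> \<in> \<int>"
      using x w by (intro Ints_sum Ints_add Ints_mult) auto
    finally show "w x \<in> \<int>" .
  qed
qed

text \<open>The factors \<open>d\<^sub>i\<^sup>-\<^sup>1\<close> in the lattices of the \<open>E\<^sub>i\<close> are chosen for this: integrality of \<open>w (f i)\<close> is
  a condition on the first component of \<open>\<alpha>\<close>, and testing the second component on the period
  \<open>d\<^sub>i\<^sup>-\<^sup>1\<close> of the second axis yields \<open>c (e i) v / d i\<close>.\<close>

lemma \<alpha>_periods_iff:
  "\<alpha> x \<in> periods (prod_torus (ell_product a b d) (dual_torus (ell_product a b d))) \<longleftrightarrow>
   x \<in> periods (prod_torus A (dual_torus A))" (is "_ \<in> periods (prod_torus ?E _) \<longleftrightarrow> _")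
proof -
  obtain v w where x: "x = (v, w)" by (cases x)
  let ?u = "fst (\<alpha> (v, w))" and ?u' = "snd (\<alpha> (v, w))"
  have u: "?u \<in> periods ?E \<longleftrightarrow> (\<forall>i. c v (f i) / of_int (d i) \<in> \<int> \<and> w (f i) \<in> \<int>)"
    by (simp add: vec_torus_def \<alpha>_def p_def)
  have emb_axis: "emb (axis i t) = t *\<^sub>R e i" for i t
  proof -
    have "emb (axis i t) = (\<Sum>j\<in>UNIV. if j = i then t *\<^sub>R e i else 0)"
      unfolding emb_def by (intro sum.cong) (auto simp: axis_def)
    then show ?thesis by simp
  qed
  have u': "(\<forall>y\<in>periods ?E. ?u' y \<in> \<int>) \<longleftrightarrow>
      (\<forall>i. w (e i) \<in> \<int> \<and> c (e i) v / of_int (d i) \<in> \<int>)"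
  proof (intro iffI allI ballI)
    fix i assume int: "\<forall>y\<in>periods ?E. ?u' y \<in> \<int>"
    let ?y1 = "axis i (axis 1 1) :: (real ^ 2) ^ 'n"
    let ?y2 = "axis i (axis 2 (1 / of_int (d i))) :: (real ^ 2) ^ 'n"
    have y: "?y1 \<in> periods ?E" "?y2 \<in> periods ?E"
      by (auto simp: vec_torus_def axis_def)
    have slices: "slice 1 ?y1 = axis i 1" "slice 2 ?y1 = axis i 0" "slice 1 ?y2 = axis i 0"
        "slice 2 ?y2 = axis i (1 / of_int (d i))"
      by (auto simp: vec_eq_iff axis_def)
    show "w (e i) \<in> \<int> \<and> c (e i) v / of_int (d i) \<in> \<int>"
      using int[rule_format, OF y(1)] int[rule_format, OF y(2)]
      by (simp add: slices emb_axis blinfun.bilinear_simps)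
  next
    fix y assume ints: "\<forall>i. w (e i) \<in> \<int> \<and> c (e i) v / of_int (d i) \<in> \<int>" and "y \<in> periods ?E"
    then have y: "y $ i $ 1 \<in> \<int>" "of_int (d i) * y $ i $ 2 \<in> \<int>" for i
      by (auto simp: vec_torus_def)
    have "?u' y = (\<Sum>i\<in>UNIV. y $ i $ 1 * w (e i) + (of_int (d i) * y $ i $ 2) * (c (e i) v / of_int (d i)))"
      by (simp add: emb_def blinfun.sum_left blinfun.sum_right blinfun.bilinear_simps sum.distrib)
    also have "\<dots> \<in> \<int>"
      by (intro Ints_sum Ints_add) (use ints y in \<open>blast intro: Ints_mult\<close>)+
    finally show "?u' y \<in> \<int>" .
  qed
  have "\<alpha> x \<in> periods (prod_torus ?E (dual_torus ?E)) \<longleftrightarrow>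
      ?u \<in> periods ?E \<and> (\<forall>y\<in>periods ?E. ?u' y \<in> \<int>)"
    unfolding x by (simp add: prod_torus_def dual_torus_def mem_Times_iff)
  also have "\<dots> \<longleftrightarrow> v \<in> periods A \<and> (\<forall>y\<in>periods A. w y \<in> \<int>)"
    unfolding u u' integral_functional_iff periods_iff by blast
  also have "\<dots> \<longleftrightarrow> x \<in> periods (prod_torus A (dual_torus A))"
    by (simp add: x prod_torus_def dual_torus_def)
  finally show ?thesis .
qed

lemma dual_cstr_c: "dual_cstr (cstr A) (c z) = c (J z)"
proof (rule blinfun_eqI)
  fix y
  have "c (J z) y = c (J (J z)) (J y)" by (rule c_J[symmetric])
  then show "dual_cstr (cstr A) (c z) y = c (J z) y"
    by (simp add: dual_cstr.rep_eq blinfun.bilinear_simps)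
qed

text \<open>By \<open>I_cstr_eq\<close> the claim consists of one equation for each component. The first is \<open>T_minus_R\<close>,
  applied to \<open>v\<close> and to \<open>z\<close> (with \<open>w = c z\<close>). The second is the first one for \<open>(J v, J z)\<close> in place
  of \<open>(v, z)\<close>, since \<open>J\<^sup>2 = -1\<close>.\<close>

lemma \<alpha>_J:
  assumes bij: "bij (blinfun_apply (det_form R))"
  shows "\<alpha> (cstr (prod_torus A (dual_torus A)) x) = I_cstr (det_form T, det_form R) (\<alpha> x)"
proof -
  obtain v w where x: "x = (v, w)" by (cases x)
  obtain z where z: "w = c z" using bij_c by (metis bij_pointE)
  have row: "det_form R (fst (\<alpha> (J v, c (J z)))) = det_form T (fst (\<alpha> (v, c z))) - snd (\<alpha> (v, c z))" for v z
  proof (rule blinfun_eqI)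
    fix y
    show "det_form R (fst (\<alpha> (J v, c (J z)))) y
        = (det_form T (fst (\<alpha> (v, c z))) - snd (\<alpha> (v, c z))) y"
      using T_minus_R[of v "slice 2 y"] T_minus_R[of z "slice 1 y"] skew[of z "emb (slice 1 y)"]
      unfolding det_form_apply[OF bilinear_R] slice_fst_\<alpha>(1) slice_fst_\<alpha>_c
        blinfun.diff_left det_form_apply[OF bilinear_T] snd_\<alpha>
      by simp
  qed
  have minus: "\<alpha> (J (J v), c (J (J z))) = - \<alpha> (v, c z)"
    using linear_neg[OF linear_\<alpha>, of "(v, c z)"] by (simp add: blinfun.bilinear_simps uminus_prod_def)
  have "det_form R (- fst (\<alpha> (v, c z))) = det_form T (fst (\<alpha> (J v, c (J z)))) - snd (\<alpha> (J v, c (J z)))"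
    using row[of "J v" "J z"] unfolding minus by simp
  then have second: "snd (\<alpha> (J v, c (J z))) = det_form R (fst (\<alpha> (v, c z))) + det_form T (fst (\<alpha> (J v, c (J z))))"
    by (simp add: blinfun.bilinear_simps algebra_simps)
  have "I_cstr (det_form T, det_form R) (fst (\<alpha> (v, c z)), snd (\<alpha> (v, c z)))
      = (fst (\<alpha> (J v, c (J z))), det_form R (fst (\<alpha> (v, c z))) + det_form T (fst (\<alpha> (J v, c (J z)))))"
    using I_cstr_eq[of "(det_form T, det_form R)" "fst (\<alpha> (J v, c (J z)))" "fst (\<alpha> (v, c z))"
        "snd (\<alpha> (v, c z))"] bij row[of v z] by simp
  also have "\<dots> = \<alpha> (J v, c (J z))"
    by (simp only: second[symmetric] prod.collapse)
  finally show ?thesis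
    by (simp add: x z prod_torus_def dual_torus_def prod_cstr.rep_eq dual_cstr_c)
qed

text \<open>With \<open>w = c z\<close>, the structure \<open>I\<^sub>\<omega>\<close> acts on the pair \<open>(v, z)\<close> by the matrix of
  \<open>ell_cstr a b\<close>, and \<open>\<alpha>\<close> sends this pair to \<open>(p v, p z)\<close>.\<close>

lemma \<alpha>_I:
  assumes b: "b \<noteq> 0"
  shows "\<alpha> (I_cstr (a *\<^sub>R c, b *\<^sub>R c) x) =
    cstr (prod_torus (ell_product a b d) (dual_torus (ell_product a b d))) (\<alpha> x)"
    (is "_ = cstr (prod_torus ?E _) _")
proof -
  obtain v w where x: "x = (v, w)" by (cases x)
  obtain z where z: "w = c z" using bij_c by (metis bij_pointE)
  let ?v = "(a / b) *\<^sub>R v - (1 / b) *\<^sub>R z" and ?z = "(b + a\<^sup>2 / b) *\<^sub>R v - (a / b) *\<^sub>R z"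
  have "bij (blinfun_apply (b *\<^sub>R c))"
    using b nondeg by (intro nondegenerate_form_bij) (simp add: blinfun.scaleR_left)
  moreover have "(b *\<^sub>R c) ?v = (a *\<^sub>R c) v - c z"
    using b by (simp add: blinfun.bilinear_simps algebra_simps)
  moreover have "(b *\<^sub>R c) v + (a *\<^sub>R c) ?v = c ?z"
    by (simp add: blinfun.bilinear_simps algebra_simps power2_eq_square)
  ultimately have I: "I_cstr (a *\<^sub>R c, b *\<^sub>R c) x = (?v, c ?z)"
    unfolding x z using I_cstr_eq[of "(a *\<^sub>R c, b *\<^sub>R c)" ?v v "c z"] by simp
  have "\<alpha> (?v, c ?z) = (cstr ?E (fst (\<alpha> x)), dual_cstr (cstr ?E) (snd (\<alpha> x)))"
  proof (rule eq_\<alpha>I)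
    show "slice 1 (cstr ?E (fst (\<alpha> x))) = p ?v"
      unfolding slice_vec_cstr x z slice_fst_\<alpha>(1) slice_fst_\<alpha>_c by (simp add: p_diff p_scale)
    have "slice 2 (cstr ?E (fst (\<alpha> x))) = p ?z"
      unfolding slice_vec_cstr x z slice_fst_\<alpha>(1) slice_fst_\<alpha>_c by (simp add: p_diff p_scale)
    then show "slice 2 (cstr ?E (fst (\<alpha> x))) = (\<chi> i. c ?z (f i) / of_int (d i))"
      by (simp add: p_def)
    fix y
    have "dual_cstr (cstr ?E) (snd (\<alpha> x)) y = - snd (\<alpha> x) (cstr ?E y)"
      by (simp add: dual_cstr.rep_eq blinfun.bilinear_simps)
    also have "\<dots> = - (c z (emb (slice 1 (cstr ?E y))) + c (emb (slice 2 (cstr ?E y))) v)"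
      unfolding x z snd_\<alpha> ..
    also have "\<dots> = c ?z (emb (slice 1 y)) + c (emb (slice 2 y)) ?v"
      unfolding slice_vec_cstr
      using skew[of z "emb (slice 1 y)"] skew[of z "emb (slice 2 y)"] skew[of v "emb (slice 1 y)"]
      by (simp add: emb_add emb_diff emb_scale blinfun.bilinear_simps algebra_simps)
    finally show "dual_cstr (cstr ?E) (snd (\<alpha> x)) y = c ?z (emb (slice 1 y)) + c (emb (slice 2 y)) ?v" .
  qed
  then show ?thesis
    unfolding I by (simp add: prod_torus_def dual_torus_def prod_cstr.rep_eq)
qed

lemma det_form_R_definite:
  assumes b: "b \<noteq> 0" and u: "u \<noteq> 0"
  shows "b * det_form R u (cstr (ell_product a b d) u) > 0"
proof -
  have nonneg: "R x x \<ge> 0" for x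
    using R_pos[of x] bilinear_lzero[OF bilinear_R] by (cases "x = 0") auto
  have "R (slice 2 u - a *\<^sub>R slice 1 u) (slice 2 u - a *\<^sub>R slice 1 u) + b\<^sup>2 * R (slice 1 u) (slice 1 u) > 0"
  proof (cases "slice 1 u = 0")
    case True
    then have "slice 2 u \<noteq> 0" using u slice_eqI[of u 0] by (auto simp: vec_eq_iff)
    then show ?thesis using True R_pos bilinear_lzero[OF bilinear_R] by simp
  next
    case False
    then show ?thesis using R_pos b nonneg by (intro add_nonneg_pos) auto
  qed
  then show ?thesis
    unfolding det_form_cstr[OF bilinear_R R_sym b] using b by simp
qed

lemma algebraic_pair_mirror:
  assumes b: "b \<noteq> 0"
  shows "algebraic_pair CARD('n) (ell_product a b d) (det_form T, det_form R)"
    (is "algebraic_pair _ ?E _")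
proof -
  have NS: "det_form T \<in> NS_real ?E" "det_form R \<in> NS_real ?E"
    using b d_pos by (auto intro!: det_form_in_NS_real bilinear_T T_sym bilinear_R R_sym)
  \<comment> \<open>The sign of \<open>b\<close> decides which of the two components of the domain contains the class.\<close>
  have "sgn b *\<^sub>R det_form R \<in> ample_cone ?E"
  proof (rule positive_in_ample_cone)
    show "sgn b *\<^sub>R det_form R \<in> NS_real ?E"
      using NS(2) by (simp add: NS_real_def span_scale)
    show "positive_form ?E (sgn b *\<^sub>R det_form R)"
      using det_form_R_definite[OF b, of _ a]
      by (auto simp: positive_form_def blinfun.scaleR_left sgn_if zero_less_mult_iff not_less split: if_splits)
  qed
  then have "det_form R \<in> ample_cone ?E \<or> - det_form R \<in> ample_cone ?E" and "\<exists>c. ample ?E c"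
    using b ample_cone_nonempty by (auto simp: sgn_if split: if_splits)
  then have "(det_form T, det_form R) \<in> kaehler_domain ?E"
    using NS(1) unfolding kaehler_domain_def by (force intro: image_eqI[of _ uminus "- det_form R"])
  moreover have "abelian_variety CARD('n) ?E"
    using \<open>\<exists>c. ample ?E c\<close> complex_torus_vec_ell[of b d a] b d_pos by (simp add: abelian_variety_def)
  ultimately show ?thesis by (simp add: algebraic_pair_def)
qed

lemma mirror_symmetric_ell_product:
  assumes b: "b \<noteq> 0"
  shows "mirror_symmetric (A, (a *\<^sub>R c, b *\<^sub>R c)) (ell_product a b d, (det_form T, det_form R))"
proof -
  let ?AA = "prod_torus A (dual_torus A)"
  let ?BB = "prod_torus (ell_product a b d) (dual_torus (ell_product a b d))"
  have "bij (blinfun_apply (det_form R))"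
    using det_form_R_definite[OF b] by (intro nondegenerate_form_bij) force
  note J = \<alpha>_J[OF this]
  have "\<alpha> ` periods ?AA = periods ?BB"
    using \<alpha>_periods_iff[of _ a b] bij_is_surj[OF bij_\<alpha>] by (auto simp: surj_def) (metis imageI)
  then show ?thesis
    unfolding mirror_symmetric_def Let_def prod.case
    using linear_\<alpha> bij_\<alpha> Q_\<alpha> J \<alpha>_I[OF b] by blast
qed

end

section \<open>Tori with Neron-Severi group of rank one\<close>

text \<open>An isomorphism \<open>h\<close> to \<open>\<int>\<close> takes the same value \<open>h(c) h(c')\<close> on \<open>h(c') c\<close> and on \<open>h(c) c'\<close>.\<close>

lemma NS_proportional:
  assumes iso: "NS_group A \<cong> integer_group" and c: "c \<in> NS A" "c \<noteq> 0" and c': "c' \<in> NS A"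
  shows "\<exists>t. c' = t *\<^sub>R c"
proof -
  obtain h where h: "h \<in> iso (NS_group A) integer_group"
    using iso by (auto simp: is_iso_def)
  have add: "h (x + y) = h x + h y" if "x \<in> NS A" "y \<in> NS A" for x y
    using h that by (auto simp: iso_def hom_def NS_group_def)
  have inj: "x = y" if "x \<in> NS A" "y \<in> NS A" "h x = h y" for x y
    using h that by (auto simp: iso_def bij_betw_def NS_group_def inj_on_def)
  have zero: "0 \<in> NS A" by (rule NS_I) simp_all
  have h0: "h 0 = 0" using add[OF zero zero] by simp
  have mult: "h (of_int k *\<^sub>R x) = k * h x" if x: "x \<in> NS A" for x k
  proof (induction k rule: int_induct[where k = 0])
    case base show ?case by (simp add: h0)
  next
    case (step1 i)
    then show ?case
      using add[OF NS_of_int_scale[OF x] x, of i] by (simp add: scaleR_add_left distrib_right)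
  next
    case (step2 i)
    then show ?case
      using add[OF NS_of_int_scale[OF x] x, of "i - 1"] by (simp add: scaleR_diff_left left_diff_distrib)
  qed
  have "of_int (h c') *\<^sub>R c = of_int (h c) *\<^sub>R c'"
    by (rule inj) (use mult c c' NS_of_int_scale in auto)
  moreover have "h c \<noteq> 0" using inj[OF c(1) zero] h0 c(2) by auto
  ultimately have "c' = (of_int (h c') / of_int (h c)) *\<^sub>R c"
    by (metis divide_inverse mult.commute of_int_eq_0_iff scaleR_scaleR scaleR_one left_inverse)
  then show ?thesis by blast
qed

lemma NS_real_line:
  assumes "NS_group A \<cong> integer_group" "c \<in> NS A" "c \<noteq> 0"
  shows "NS_real A = range (\<lambda>t. t *\<^sub>R c)"
proof -
  have "NS A \<subseteq> span {c}" using NS_proportional[OF assms] by (auto simp: span_singleton)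
  then have "span (NS A) = span {c}"
    using assms(2) by (intro antisym span_minimal subspace_span) (auto intro: span_base)
  then show ?thesis by (simp add: NS_real_def span_singleton)
qed

lemma ample_cone_in_NS_real:
  assumes "h \<in> ample_cone A" shows "h \<in> NS_real A"
proof -
  obtain S r where S: "h = (\<Sum>c\<in>S. r c *\<^sub>R c)" "\<forall>c\<in>S. ample A c"
    using assms by (auto simp: ample_cone_def)
  then have "S \<subseteq> NS A" by (auto simp: ample_def)
  then show ?thesis
    unfolding S(1) NS_real_def by (intro span_sum span_scale span_base) blast
qed

lemma ample_cone_positive:
  assumes "h \<in> ample_cone A" shows "positive_form A h"
proof -
  obtain S r where S: "h = (\<Sum>c\<in>S. r c *\<^sub>R c)" "finite S" "S \<noteq> {}" "\<forall>c\<in>S. ample A c \<and> r c > 0"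
    using assms by (auto simp: ample_cone_def)
  then show ?thesis
    unfolding positive_form_def S(1) blinfun.sum_left blinfun.scaleR_left
    by (auto intro!: sum_pos simp: ample_def)
qed

lemma ample_cone_ray:
  fixes A :: "'v::euclidean_space torus"
  assumes "NS_group A \<cong> integer_group" and c: "ample A c"
  shows "ample_cone A = {t *\<^sub>R c | t. t > 0}"
proof -
  obtain v :: 'v where v: "v \<noteq> 0" using nonempty_Basis nonzero_Basis by blast
  have cv: "c v (cstr A v) > 0" using c v by (simp add: ample_def)
  then have "c \<noteq> 0" by auto
  then have line: "NS_real A = range (\<lambda>t. t *\<^sub>R c)"
    using NS_real_line assms by (auto simp: ample_def)
  show ?thesis
  proof (intro equalityI subsetI)
    fix h assume h: "h \<in> ample_cone A"
    then obtain t where t: "h = t *\<^sub>R c" using ample_cone_in_NS_real line by blast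
    have "h v (cstr A v) > 0" using ample_cone_positive[OF h] v by (simp add: positive_form_def)
    then have "t > 0" using cv by (simp add: t blinfun.scaleR_left zero_less_mult_iff)
    then show "h \<in> {t *\<^sub>R c | t. t > 0}" using t by blast
  qed (use ample_scale_in_ample_cone[OF c] in blast)
qed

lemma kaehler_domain_rank_one:
  fixes A :: "'v::euclidean_space torus"
  assumes "NS_group A \<cong> integer_group" and c: "ample A c"
  shows "kaehler_domain A = {(a *\<^sub>R c, b *\<^sub>R c) | a b. b \<noteq> 0}"
    and "NS_complex_nondeg A = {(a *\<^sub>R c, b *\<^sub>R c) | a b. b \<noteq> 0}"
proof -
  obtain v :: 'v where v: "v \<noteq> 0" using nonempty_Basis nonzero_Basis by blast
  have pos: "c u (cstr A u) > 0" if "u \<noteq> 0" for u using c that by (simp add: ample_def)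
  have "c \<noteq> 0" using pos[OF v] by auto
  then have line: "NS_real A = range (\<lambda>t. t *\<^sub>R c)"
    using NS_real_line assms by (auto simp: ample_def)
  have "uminus ` ample_cone A = {b *\<^sub>R c | b. b < 0}"
    unfolding ample_cone_ray[OF assms]
  proof (intro equalityI subsetI)
    fix h assume "h \<in> {b *\<^sub>R c | b. b < 0}"
    then obtain b where "b < 0" "h = - ((- b) *\<^sub>R c)" by auto
    moreover have "(- b) *\<^sub>R c \<in> {t *\<^sub>R c | t. t > 0}" using \<open>b < 0\<close> by (intro CollectI exI[of _ "- b"]) simp
    ultimately show "h \<in> uminus ` {t *\<^sub>R c | t. t > 0}" by blast
  next
    fix h assume "h \<in> uminus ` {t *\<^sub>R c | t. t > 0}"
    then obtain t where "t > 0" "h = (- t) *\<^sub>R c" by auto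
    then show "h \<in> {b *\<^sub>R c | b. b < 0}" by (intro CollectI exI[of _ "- t"]) auto
  qed
  then show "kaehler_domain A = {(a *\<^sub>R c, b *\<^sub>R c) | a b. b \<noteq> 0}"
    unfolding kaehler_domain_def line ample_cone_ray[OF assms] by (auto simp: neq_iff)
  have "(\<forall>u. (\<forall>y. (b *\<^sub>R c) u y = 0) \<longrightarrow> u = 0) \<longleftrightarrow> b \<noteq> 0" for b
  proof
    assume "\<forall>u. (\<forall>y. (b *\<^sub>R c) u y = 0) \<longrightarrow> u = 0"
    then show "b \<noteq> 0" using v by (metis blinfun.zero_left scaleR_zero_left)
  next
    assume b: "b \<noteq> 0"
    show "\<forall>u. (\<forall>y. (b *\<^sub>R c) u y = 0) \<longrightarrow> u = 0"
    proof (intro allI impI)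
      fix u assume "\<forall>y. (b *\<^sub>R c) u y = 0"
      then have "c u (cstr A u) = 0" using b by (simp add: blinfun.scaleR_left)
      then show "u = 0" using pos[of u] by fastforce
    qed
  qed
  then have "NS_real_nondeg A = {b *\<^sub>R c | b. b \<noteq> 0}"
    unfolding NS_real_nondeg_def line by blast
  then show "NS_complex_nondeg A = {(a *\<^sub>R c, b *\<^sub>R c) | a b. b \<noteq> 0}"
    unfolding NS_complex_nondeg_def line by auto
qed

theorem corollary9p6p3:
  fixes A :: "'v::euclidean_space torus"
  assumes "abelian_variety CARD('n::finite) A"
    and "NS_group A \<cong> integer_group"
  shows "kaehler_domain A = NS_complex_nondeg A \<and>
    (\<forall>\<omega>A \<in> kaehler_domain A.
       \<exists>(E :: 'n \<Rightarrow> (real ^ 2) torus) \<omega>E.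
         (\<forall>i. elliptic_curve (E i)) \<and> (\<forall>i j. isogenous (E i) (E j)) \<and>
         algebraic_pair CARD('n) (vec_torus E) \<omega>E \<and>
         mirror_symmetric (A, \<omega>A) (vec_torus E, \<omega>E))"
proof -
  obtain c where c: "ample A c" and torus: "complex_torus CARD('n) A"
    using assms(1) by (auto simp: abelian_variety_def)
  note domain = kaehler_domain_rank_one[OF assms(2) c]
  have NS: "c \<in> NS A" and pos: "\<And>v. v \<noteq> 0 \<Longrightarrow> c v (cstr A v) > 0"
    using c by (simp_all add: ample_def)
  have lattice: "full_lattice (2 * CARD('n)) (periods A)"
    using torus by (simp add: complex_torus_def)
  have nondeg: "x = 0" if "\<And>y. c x y = 0" for x
    using pos[of x] that by fastforce
  obtain e f :: "'n \<Rightarrow> 'v" and d :: "'n \<Rightarrow> int" where "symplectic_polarization A c e f d"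
  proof (rule symplectic_basis[OF lattice NS_skew[OF NS] NS_integral[OF NS] nondeg])
    fix e f :: "'n \<Rightarrow> 'v" and d :: "'n \<Rightarrow> int"
    assume "\<And>i. d i > 0" "\<And>i j. c (e i) (e j) = 0" "\<And>i j. c (f i) (f j) = 0"
      and "\<And>i j. c (e i) (f j) = (if i = j then of_int (d i) else 0)"
      and "\<And>x. x = (\<Sum>i\<in>UNIV. (c x (f i) / of_int (d i)) *\<^sub>R e i + (c (e i) x / of_int (d i)) *\<^sub>R f i)"
      and "\<And>x. x \<in> periods A \<longleftrightarrow>
        (\<forall>i. c x (f i) / of_int (d i) \<in> \<int> \<and> c (e i) x / of_int (d i) \<in> \<int>)"
    with torus c have "symplectic_polarization A c e f d"
      by (rule symplectic_polarization.intro)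
    then show thesis by (rule that)
  qed
  then interpret symplectic_polarization A c e f d .
  have "\<exists>(E :: 'n \<Rightarrow> (real ^ 2) torus) \<omega>E.
         (\<forall>i. elliptic_curve (E i)) \<and> (\<forall>i j. isogenous (E i) (E j)) \<and>
         algebraic_pair CARD('n) (vec_torus E) \<omega>E \<and>
         mirror_symmetric (A, \<omega>A) (vec_torus E, \<omega>E)" if \<omega>A: "\<omega>A \<in> kaehler_domain A" for \<omega>A
  proof -
    obtain a b where \<omega>: "\<omega>A = (a *\<^sub>R c, b *\<^sub>R c)" "b \<noteq> 0" using \<omega>A unfolding domain by blast
    show ?thesis
      unfolding \<omega>(1) using \<omega>(2) d_pos
      by (intro exI[of _ "\<lambda>i. ell_torus a b (d i)"] exI[of _ "(det_form T, det_form R)"] conjI allI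
          elliptic_curve_ell_torus isogenous_ell_torus algebraic_pair_mirror
          mirror_symmetric_ell_product)
  qed
  moreover have "kaehler_domain A = NS_complex_nondeg A" by (simp only: domain)
  ultimately show ?thesis by (intro conjI ballI)
qed

end
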